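(* Let $\lambda>0$, $d_v>0$, $\epsilon\ge 0$, and $m=\lambda\pi d_v^2$. With the range vectors $\mathbf R_{\mathbf 0},\mathbf R_{\mathbf x}$ and the distance $\Delta_p$ as in the context, $$P_{\rm Loc}=\mathbb P\big[\Delta_p(\mathbf R_{\mathbf 0},\mathbf R_{\mathbf x})>\epsilon\big]=\begin{cases}1-e^{-2m}\, I_0\!\left(2m\sqrt{\dfrac{8d_v^3\epsilon-6d_v^2\epsilon^2+\epsilon^4}{3d_v^4}}\right), & 0\le\epsilon<d_v,\\[2mm] 1-e^{-2m}\, I_0(2m), & \epsilon\ge d_v.\end{cases}$$
   Context: Fix an intensity $\lambda>0$ and a maximum visibility distance $d_v>0$, and put $m=\lambda\pi d_v^2$. Following the paper's model, the landmarks seen from the origin $\mathbf 0$ and those seen from a second location $\mathbf x\in\mathbb R^2$ are given by two independent homogeneous Poisson point processes $\Phi_{\mathbf 0}$ and $\Phi_{\mathbf x}$ on $\mathbb R^2$ of intensity $\lambda$. A landmark is visible from a location if its Euclidean distance to that location is at most $d_v$. Let $N_{\mathbf 0}$ be the number of points of $\Phi_{\mathbf 0}$ in the closed disk of radius $d_v$ centred at $\mathbf 0$ and $N_{\mathbf x}$ the number of points of $\Phi_{\mathbf x}$ in the closed disk of radius $d_v$ centred at $\mathbf x$ (independent Poisson random variables of mean $m$). The range vector $\mathbf R_{\mathbf 0}\in\mathbb R^{N_{\mathbf 0}}$ lists the Euclidean distances from $\mathbf 0$ to the visible landmarks of $\Phi_{\mathbf 0}$, ordered clockwise by bearing starting from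 a fixed reference direction ("true north"); $\mathbf R_{\mathbf x}\in\mathbb R^{N_{\mathbf x}}$ is defined in the same way from $\Phi_{\mathbf x}$ with distances and bearings measured from $\mathbf x$. For real vectors $\mathbf u,\mathbf v$, $\Delta_p(\mathbf u,\mathbf v)=\|\mathbf u-\mathbf v\|_\infty$ if $\dim\mathbf u=\dim\mathbf v$ (this equals $0$ when both are empty) and $\Delta_p(\mathbf u,\mathbf v)=\infty$ otherwise. The localizability probability with noise level $\epsilon$ is $P_{\rm Loc}=\mathbb P[\Delta_p(\mathbf R_{\mathbf 0},\mathbf R_{\mathbf x})>\epsilon]$. $I_0$ is the modified Bessel function of the first kind of order zero. *)

theory Defs
  imports "HOL-Probability.Probability"
begin

text \<open>Points of the plane are complex numbers; true north is the direction of the imaginary unit.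
  A point configuration is a (locally finite) set of points.\<close>

definition pcount :: "complex set \<Rightarrow> complex set \<Rightarrow> nat" where
  "pcount Phi B = card (Phi \<inter> B)"

definition poisson_pp :: "'a measure \<Rightarrow> ('a \<Rightarrow> complex set) \<Rightarrow> real \<Rightarrow> bool" where
  "poisson_pp M Phi lam \<longleftrightarrow>
     (\<forall>B. B \<in> sets borel \<and> bounded B \<longrightarrow>
        (\<forall>\<omega>\<in>space M. finite (Phi \<omega> \<inter> B)) \<and>
        (\<lambda>\<omega>. pcount (Phi \<omega>) B) \<in> measurable M (count_space UNIV) \<and>
        (\<forall>k::nat. measure M {\<omega> \<in> space M. pcount (Phi \<omega>) B = k}
            = (lam * measure lborel B) ^ k / fact k * exp (- (lam * measure lborel B)))) \<and>
     (\<forall>(I::nat set) (B::nat \<Rightarrow> complex set). finite I \<longrightarrow> disjoint_family_on B I \<longrightarrow>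
        (\<forall>i\<in>I. B i \<in> sets borel \<and> bounded (B i)) \<longrightarrow>
        prob_space.indep_vars M (\<lambda>_. count_space UNIV) (\<lambda>i \<omega>. pcount (Phi \<omega>) (B i)) I)"

text \<open>Independence of two point processes: the joint count vectors over arbitrary finite families
  of bounded Borel sets are independent (these generate the sigma-algebras of the processes).\<close>
definition indep_pp :: "'a measure \<Rightarrow> ('a \<Rightarrow> complex set) \<Rightarrow> ('a \<Rightarrow> complex set) \<Rightarrow> bool" where
  "indep_pp M Phi Psi \<longleftrightarrow>
     (\<forall>(n::nat) (A::nat \<Rightarrow> complex set) (B::nat \<Rightarrow> complex set).
        (\<forall>i<n. A i \<in> sets borel \<and> bounded (A i) \<and> B i \<in> sets borel \<and> bounded (B i)) \<longrightarrow>
        prob_space.indep_var M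
          (PiM {..<n} (\<lambda>_. count_space (UNIV::nat set))) (\<lambda>\<omega>. \<lambda>i\<in>{..<n}. pcount (Phi \<omega>) (A i))
          (PiM {..<n} (\<lambda>_. count_space (UNIV::nat set))) (\<lambda>\<omega>. \<lambda>i\<in>{..<n}. pcount (Psi \<omega>) (B i)))"

text \<open>Bearing of a displacement z: clockwise angle from true north (direction \<i>), in [0, 2 pi).\<close>
definition bearing :: "complex \<Rightarrow> real" where
  "bearing z = (let t = pi / 2 - Arg z in if t < 0 then t + 2 * pi else t)"

text \<open>Range vector seen from location c: distances to the landmarks of Phi within distance dv,
  ordered clockwise by bearing from north (ties, a null event, broken by distance).\<close>
definition lex_less :: "real \<times> real \<Rightarrow> real \<times> real \<Rightarrow> bool" where
  "lex_less p q \<longleftrightarrow> fst p < fst q \<or> (fst p = fst q \<and> snd p < snd q)"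

definition range_vec :: "real \<Rightarrow> complex \<Rightarrow> complex set \<Rightarrow> real list" where
  "range_vec dv c Phi =
     map snd (THE xs. set xs = (\<lambda>p. (bearing (p - c), dist p c)) ` (Phi \<inter> cball c dv)
                      \<and> sorted_wrt lex_less xs)"

definition Delta_p :: "real list \<Rightarrow> real list \<Rightarrow> ereal" where
  "Delta_p u v = (if length u = length v
      then ereal (Max (insert 0 {\<bar>u ! i - v ! i\<bar> | i. i < length u})) else \<infinity>)"

definition bessel_I0 :: "real \<Rightarrow> real" where
  "bessel_I0 x = (\<Sum>k. ((x / 2) ^ k / fact k) ^ 2)"

end

theory Submission
  imports Defs
begin

text \<open>
  Cut the disk into \<open>n\<close> congruent sectors. When every sector contains at most one landmark, the
  order by bearing is the order of the occupied sectors, so the event that the range vector has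
  length \<open>k\<close> with \<open>i\<close>-th entry in \<open>A i\<close> is a disjoint union, over the \<open>k\<close>-subsets of sectors, of
  events on the counts of \<open>k + 1\<close> disjoint sets. By rotation invariance each has probability
  \<open>exp (- m) * (\<Prod>i<k. m / n * \<mu> (A i))\<close>, where \<open>\<mu>\<close> is the law of the radius of a uniform point of
  the disk. Two landmarks share a sector with probability at most \<open>m\<^sup>2 / n\<close>, and
  \<open>(n choose k) / n ^ k\<close> tends to \<open>1 / fact k\<close>; hence the length is Poisson and, given the length,
  the entries are independent with law \<open>\<mu>\<close>. The same computation for both processes at once gives
  the joint law, and the probability of lengths \<open>k\<close> with all entries \<open>\<epsilon>\<close>-close is
  \<open>(exp (- m) * m ^ k / fact k)\<^sup>2 * q ^ k\<close> with \<open>q\<close> the probability that two independent radii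
  differ by at most \<open>\<epsilon>\<close>. Summing over \<open>k\<close> gives the Bessel series.

  Landmarks with equal bearings form a null event, but the probability space need not be complete,
  so measurability of the range vector has to be exact: there the sectors are replaced by a grid
  in bearing and distance, which for fine meshes reproduces the lexicographic order of any given
  finite configuration.
\<close>

section \<open>Rotation invariance and the polar decomposition of Lebesgue measure\<close>

text \<open>Boxes correspond to boxes with the same side lengths, and boxes determine the measure.
  The identification makes invariance under orthogonal maps of \<open>real^2\<close> available for
  complex rotations.\<close>

lemma lborel_distr_Complex: "distr lborel borel (\<lambda>v::real^2. Complex (v $ 1) (v $ 2)) = lborel"
proof (rule lborel_eqI[symmetric])
  have [measurable]: "(\<lambda>v::real^2. Complex (v $ 1) (v $ 2)) \<in> borel_measurable borel"
    unfolding Complex_eq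
    by (intro borel_measurable_continuous_onI continuous_intros)
  show "sets (distr lborel borel (\<lambda>v::real^2. Complex (v $ 1) (v $ 2))) = sets borel" by simp
  fix l u :: complex
  assume lu: "\<And>b. b \<in> Basis \<Longrightarrow> l \<bullet> b \<le> u \<bullet> b"
  have pre: "(\<lambda>v::real^2. Complex (v $ 1) (v $ 2)) -` box l u
      = box (vector [Re l, Im l]) (vector [Re u, Im u])"
    by (auto simp: in_box_complex_iff mem_box_cart forall_2)
  have le: "Re l \<le> Re u" "Im l \<le> Im u"
    using lu[of 1] lu[of \<i>] by (auto simp: Basis_complex_def)
  have "emeasure (distr lborel borel (\<lambda>v::real^2. Complex (v $ 1) (v $ 2))) (box l u)
      = emeasure lborel (box (vector [Re l, Im l] :: real^2) (vector [Re u, Im u]))"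
    by (subst emeasure_distr) (auto simp: pre)
  also have "\<dots> = ennreal (\<Prod>b\<in>Basis. (vector [Re u, Im u] - vector [Re l, Im l] :: real^2) \<bullet> b)"
    by (rule emeasure_lborel_box) (use le in \<open>auto simp: Basis_vec_def inner_axis forall_2 UNIV_2\<close>)
  also have "(\<Prod>b\<in>Basis. (vector [Re u, Im u] - vector [Re l, Im l] :: real^2) \<bullet> b)
      = (\<Prod>i\<in>UNIV. (vector [Re u, Im u] - vector [Re l, Im l] :: real^2) $ i)"
  proof -
    have B: "(Basis :: (real^2) set) = (\<lambda>i. axis i 1) ` UNIV"
      by (auto simp: Basis_vec_def)
    have "inj (\<lambda>i::2. axis i (1::real))"
      by (auto simp: inj_on_def axis_eq_axis)
    then show ?thesis
      unfolding B by (subst prod.reindex) (auto simp: inner_axis)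
  qed
  also have "\<dots> = (\<Prod>b\<in>Basis. (u - l) \<bullet> b)"
    by (auto simp: UNIV_2 Basis_complex_def)
  finally show "emeasure (distr lborel borel (\<lambda>v::real^2. Complex (v $ 1) (v $ 2))) (box l u)
      = ennreal (\<Prod>b\<in>Basis. (u - l) \<bullet> b)" .
qed

text \<open>In the coordinates of \<open>real^2\<close>, multiplication by a unit complex number is
  an orthogonal transformation, and these preserve Lebesgue measure. Again boxes suffice.\<close>

lemma lborel_distr_rotation:
  fixes w :: complex
  assumes w: "norm w = 1"
  shows "distr lborel borel ((*) w) = lborel"
proof (rule lborel_eqI[symmetric])
  show "sets (distr lborel borel ((*) w)) = sets borel" by simp
  fix l u :: complex
  assume lu: "\<And>b. b \<in> Basis \<Longrightarrow> l \<bullet> b \<le> u \<bullet> b"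
  define h where "h = (\<lambda>v::real^2. Complex (v $ 1) (v $ 2))"
  have h[measurable]: "h \<in> borel_measurable borel"
    unfolding h_def Complex_eq
    by (intro borel_measurable_continuous_onI continuous_intros)
  \<comment> \<open>\<open>T\<close> is the inverse rotation, multiplication by
    \<open>cnj w\<close>, in coordinates. The push-forward involves preimages under
    \<open>w\<close>, whereas invariance under orthogonal maps speaks of images; images under the
    inverse rotation reconcile the two.\<close>
  define T where "T = (\<lambda>v::real^2. vector [Re (cnj w * h v), Im (cnj w * h v)] :: real^2)"
  have ww: "w * cnj w = 1"
    using w by (simp add: complex_norm_square[symmetric])
  have wz: "w * (cnj w * z) = z" "cnj w * (w * z) = z" for z
    using ww by (simp_all add: mult.assoc[symmetric] mult.commute)
  have hT: "h (T v) = cnj w * h v" for v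
    by (simp add: h_def T_def complex_eq_iff)
  have normh: "norm (h v) = norm v" for v
    by (simp add: h_def cmod_def norm_vec_def L2_set_def UNIV_2)
  have linT: "linear T"
    by (rule linearI) (auto simp: T_def h_def vec_eq_iff forall_2 algebra_simps)
  have orth: "orthogonal_transformation T"
    unfolding orthogonal_transformation
    by (metis linT hT normh norm_mult complex_mod_cnj w mult_1)
  have inj_h: "h a = h b \<Longrightarrow> a = b" for a b
    by (auto simp: h_def vec_eq_iff forall_2)
  have surj_h: "h (vector [Re z, Im z]) = z" for z
    by (simp add: h_def)
  have img: "h -` ((*) w -` box l u) = T ` (h -` box l u)"
  proof (intro set_eqI iffI)
    fix v assume v: "v \<in> h -` ((*) w -` box l u)"
    have "T (vector [Re (w * h v), Im (w * h v)]) = v"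
      by (rule inj_h) (simp only: hT surj_h wz)
    moreover have "vector [Re (w * h v), Im (w * h v)] \<in> h -` box l u"
      using v by (simp only: surj_h vimage_eq)
    ultimately show "v \<in> T ` (h -` box l u)" by (metis imageI)
  next
    fix v assume "v \<in> T ` (h -` box l u)"
    then show "v \<in> h -` ((*) w -` box l u)" by (auto simp: hT wz)
  qed
  have em: "emeasure lborel S = emeasure lborel (h -` S)" if [measurable]: "S \<in> sets borel" for S
    by (subst lborel_distr_Complex[folded h_def, symmetric], subst emeasure_distr) auto
  have [measurable]: "(*) w -` box l u \<in> sets borel"
    using measurable_sets[of "(*) w" borel borel "box l u"] by simp
  have pre_borel: "h -` ((*) w -` box l u) \<in> sets borel"
    using measurable_sets[OF h, of "(*) w -` box l u"] by simp
  have box_borel: "h -` box l u \<in> sets borel"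
    using measurable_sets[OF h, of "box l u"] by simp
  have fin: "emeasure lborel (h -` box l u) < \<infinity>"
    by (subst em[symmetric]) (auto simp: emeasure_lborel_box_eq)
  have lm: "h -` box l u \<in> lmeasurable"
    using box_borel fin by (intro fmeasurableI) (auto simp: emeasure_completion)
  have "emeasure (distr lborel borel ((*) w)) (box l u) = emeasure lborel ((*) w -` box l u)"
    by (subst emeasure_distr) auto
  also have "\<dots> = emeasure lborel (T ` (h -` box l u))"
    by (simp add: em img)
  also have "\<dots> = emeasure lebesgue (T ` (h -` box l u))"
    using pre_borel by (simp add: img)
  also have "\<dots> = ennreal (measure lebesgue (T ` (h -` box l u)))"
    using measurable_orthogonal_image[OF orth lm] by (simp add: emeasure_eq_measure2)
  also have "\<dots> = ennreal (measure lebesgue (h -` box l u))"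
    by (simp add: measure_orthogonal_image[OF orth lm])
  also have "\<dots> = emeasure lebesgue (h -` box l u)"
    using lm by (simp add: emeasure_eq_measure2)
  also have "\<dots> = emeasure lborel (box l u)"
    using box_borel by (simp add: em)
  also have "\<dots> = ennreal (\<Prod>b\<in>Basis. (u - l) \<bullet> b)"
    by (rule emeasure_lborel_box[OF lu])
  finally show "emeasure (distr lborel borel ((*) w)) (box l u)
      = ennreal (\<Prod>b\<in>Basis. (u - l) \<bullet> b)" .
qed

section \<open>Bearings as clockwise polar angles\<close>

text \<open>\<open>Arg\<close> is continuous off the closed negative real axis and constant
  \<open>pi\<close> on that axis, apart from the value 0 at the origin.\<close>

lemma borel_measurable_Arg [measurable]: "Arg \<in> borel_measurable borel"
proof -
  have [measurable]: "(\<lambda>z. if z \<in> - \<real>\<^sub>\<le>\<^sub>0 then Arg z else pi) \<in> borel_measurable borel"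
    by (intro borel_measurable_continuous_on_if continuous_on_Arg continuous_on_const) auto
  have "Arg = (\<lambda>z. if z = 0 then 0 else if z \<in> - \<real>\<^sub>\<le>\<^sub>0 then Arg z else pi)"
    by (auto simp: fun_eq_iff Arg_zero complex_nonpos_Reals_iff Arg_eq_pi order_less_le)
      (metis complex_eq_iff zero_complex.sel)
  then show ?thesis
    by (rule ssubst) measurable
qed

lemma bearing_bounds: "0 \<le> bearing z" "bearing z < 2 * pi"
  using Arg_bounded[of z] pi_gt_zero by (auto simp: bearing_def Let_def)

lemma borel_measurable_bearing [measurable]: "bearing \<in> borel_measurable borel"
  unfolding bearing_def[abs_def] Let_def by measurable

lemma rcis_bearing: "rcis (norm z) (pi / 2 - bearing z) = z"
proof -
  have "cis (Arg z - 2 * pi) = cis (Arg z)"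
    by (simp add: cis_divide[symmetric])
  then have "cis (pi / 2 - bearing z) = cis (Arg z)"
    by (auto simp: bearing_def Let_def)
  then show ?thesis
    using rcis_cmod_Arg[of z] by (simp add: rcis_def)
qed

lemma bearing_norm_inj: "bearing z = bearing w \<Longrightarrow> norm z = norm w \<Longrightarrow> z = w"
  by (metis rcis_bearing)

lemma bearing_rcis:
  assumes "r > 0" "0 \<le> b" "b < 2 * pi"
  shows "bearing (rcis r (pi / 2 - b)) = b"
\<comment> \<open>\<open>Arg\<close> takes values in the interval from \<open>- pi\<close>
  (excluded) to \<open>pi\<close>. The angle \<open>pi / 2 - b\<close> lies there exactly when
  \<open>b < 3 * pi / 2\<close>; otherwise it has to be raised by \<open>2 * pi\<close>.\<close>
proof (cases "b < 3 * pi / 2")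
  case True
  then have "Arg (rcis r (pi / 2 - b)) = pi / 2 - b"
    using assms by (intro Arg_rcis) auto
  then show ?thesis using assms by (simp add: bearing_def)
next
  case False
  have "cis (pi / 2 - b + 2 * pi) = cis (pi / 2 - b)"
    by (subst cis_mult[symmetric]) simp
  then have "Arg (rcis r (pi / 2 - b)) = Arg (rcis r (pi / 2 - b + 2 * pi))"
    by (simp add: rcis_def)
  also have "\<dots> = pi / 2 - b + 2 * pi"
    using assms False by (intro Arg_rcis) auto
  finally show ?thesis using assms by (simp add: bearing_def)
qed

text \<open>Bearings run clockwise, so a clockwise rotation by \<open>t\<close> adds
  \<open>t\<close>. The two bounds exclude wrap-around at north, and the origin is excluded because
  rotation does not move it.\<close>

lemma bearing_rotate:
  assumes "z \<noteq> 0" "0 \<le> bearing z + t" "bearing z + t < 2 * pi"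
  shows "bearing (cis (- t) * z) = bearing z + t"
proof -
  have "cis (- t) * z = rcis (norm z) (pi / 2 - (bearing z + t))"
  proof -
    have "pi / 2 - (bearing z + t) = - t + (pi / 2 - bearing z)" by simp
    then have "rcis (norm z) (pi / 2 - (bearing z + t)) = cis (- t) * rcis (norm z) (pi / 2 - bearing z)"
      unfolding rcis_def by (metis cis_mult mult.left_commute)
    then show ?thesis by (simp add: rcis_bearing)
  qed
  then show ?thesis using assms bearing_rcis[of "norm z" "bearing z + t"] by simp
qed

section \<open>Congruent sectors of the disk and the law of the radius\<close>

definition sector :: "nat \<Rightarrow> complex \<Rightarrow> complex \<Rightarrow> nat" where
  "sector n c p = nat \<lfloor>real n * bearing (p - c) / (2 * pi)\<rfloor>"

definition radial :: "real \<Rightarrow> real measure" where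
  "radial d = distr (uniform_measure lborel (cball 0 d)) borel (norm :: complex \<Rightarrow> real)"

lemma measurable_sector [measurable]: "sector n c \<in> measurable borel (count_space UNIV)"
  unfolding sector_def[abs_def] by measurable

lemma sector_less: "n > 0 \<Longrightarrow> sector n c p < n"
  using bearing_bounds[of "p - c"] by (simp add: sector_def nat_less_iff floor_less_iff field_simps)

lemma sector_eq_iff:
  "n > 0 \<Longrightarrow> sector n c p = j \<longleftrightarrow>
    2 * pi * real j / real n \<le> bearing (p - c) \<and> bearing (p - c) < 2 * pi * (real j + 1) / real n"
proof -
  assume n: "n > 0"
  have "0 \<le> \<lfloor>real n * bearing (p - c) / (2 * pi)\<rfloor>"
    using bearing_bounds(1)[of "p - c"] by simp
  then have "sector n c p = j \<longleftrightarrow> \<lfloor>real n * bearing (p - c) / (2 * pi)\<rfloor> = int j"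
    unfolding sector_def by linarith
  also have "\<dots> \<longleftrightarrow> real j \<le> real n * bearing (p - c) / (2 * pi) \<and>
      real n * bearing (p - c) / (2 * pi) < real j + 1"
    by (simp add: floor_eq_iff)
  also have "\<dots> \<longleftrightarrow> 2 * pi * real j / real n \<le> bearing (p - c) \<and>
      bearing (p - c) < 2 * pi * (real j + 1) / real n"
    using n by (simp add: field_simps)
  finally show ?thesis .
qed

lemma measure_disk: "d \<ge> 0 \<Longrightarrow> measure lborel (cball (c::complex) d) = pi * d\<^sup>2"
  by (simp add: content_cball unit_ball_vol_2)

lemma emeasure_disk: "d \<ge> 0 \<Longrightarrow> emeasure lborel (cball (c::complex) d) = ennreal (pi * d\<^sup>2)"
  by (simp add: emeasure_cball unit_ball_vol_2)

lemma prob_space_radial: "d > 0 \<Longrightarrow> prob_space (radial d)"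
  unfolding radial_def
  by (intro prob_space.prob_space_distr prob_space_uniform_measure) (auto simp: emeasure_disk)

lemma sets_radial [simp, measurable_cong]: "sets (radial d) = sets borel"
  by (simp add: radial_def)

lemma space_radial [simp]: "space (radial d) = UNIV"
  by (simp add: radial_def)

lemma measure_radial:
  assumes "d > 0" and [measurable]: "A \<in> sets borel"
  shows "measure (radial d) A = measure lborel {z::complex. norm z \<le> d \<and> norm z \<in> A} / (pi * d\<^sup>2)"
proof -
  have "measure (radial d) A = measure (uniform_measure lborel (cball 0 d)) (norm -` A \<inter> space lborel :: complex set)"
    unfolding radial_def by (subst measure_distr) auto
  also have "norm -` A \<inter> space lborel = {z::complex. norm z \<in> A}" by auto
  also have "measure (uniform_measure lborel (cball 0 d)) {z::complex. norm z \<in> A}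
      = measure lborel (cball 0 d \<inter> {z::complex. norm z \<in> A}) / measure lborel (cball (0::complex) d)"
    by (rule measure_uniform_measure) (use assms in \<open>auto simp: emeasure_disk\<close>)
  also have "cball 0 d \<inter> {z::complex. norm z \<in> A} = {z. norm z \<le> d \<and> norm z \<in> A}"
    by auto
  finally show ?thesis using assms by (simp add: measure_disk)
qed

text \<open>Each sector is a rotated copy of sector 0, so the \<open>n\<close> sectors share the
  measure of the annular set equally. For a uniform point of the disk this says that sector and
  distance are independent.\<close>

lemma measure_sector_annulus:
  assumes d: "d > 0" and n: "n > 0" and j: "j < n" and A[measurable]: "A \<in> sets borel"
  shows "measure lborel {p \<in> cball c d. dist p c \<in> A \<and> sector n c p = j}
    = pi * d\<^sup>2 / real n * measure (radial d) A"
proof -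
  \<comment> \<open>The origin is left out because its bearing does not change under rotation; as a
    single point it has measure zero.\<close>
  define U where "U i = {z::complex. z \<noteq> 0 \<and> norm z \<le> d \<and> norm z \<in> A \<and> sector n 0 z = i}" for i
  have [measurable]: "U i \<in> sets borel" for i
    unfolding U_def by measurable
  have rot: "measure lborel (U i) = measure lborel (U 0)" if i: "i < n" for i
  proof -
    define t where "t = 2 * pi * real i / real n"
    have fin: "2 * pi * (real i + 1) / real n \<le> 2 * pi"
      using i n by (simp add: divide_le_eq)
    have "cis (- t) * z \<in> U i \<longleftrightarrow> z \<in> U 0" for z
    proof (cases "z = 0")
      case False
      let ?w = "cis (- t) * z"
      have nw: "norm ?w = norm z" by (simp add: norm_mult)
      have "sector n 0 ?w = i \<longleftrightarrow> sector n 0 z = 0"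
      proof
        assume "sector n 0 z = 0"
        then have b: "0 \<le> bearing z" "bearing z < 2 * pi / real n"
          using n by (auto simp: sector_eq_iff)
        then have "bearing z + t < 2 * pi * (real i + 1) / real n"
          by (simp add: t_def add_divide_distrib distrib_left)
        moreover have "0 \<le> t" by (simp add: t_def)
        ultimately show "sector n 0 ?w = i"
          using False b fin n by (simp add: sector_eq_iff bearing_rotate) (simp add: t_def)
      next
        assume "sector n 0 ?w = i"
        then have b: "t \<le> bearing ?w" "bearing ?w < 2 * pi * (real i + 1) / real n"
          using n by (auto simp: sector_eq_iff t_def)
        have undo: "cis (- (- t)) * ?w = z"
          by (simp add: mult.assoc[symmetric] cis_mult)
        have "0 \<le> t" by (simp add: t_def)
        then have "bearing (cis (- (- t)) * ?w) = bearing ?w + - t"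
          using False b bearing_bounds(2)[of ?w] by (intro bearing_rotate) auto
        then have "bearing z = bearing ?w - t" unfolding undo by (simp only: add_uminus_conv_diff)
        then show "sector n 0 z = 0"
          using b n by (simp add: sector_eq_iff t_def add_divide_distrib distrib_left)
      qed
      then show ?thesis using False nw by (simp add: U_def norm_mult)
    qed (simp add: U_def)
    then have "(*) (cis (- t)) -` U i \<inter> space lborel = U 0" by auto
    moreover have "measure lborel (U i) = measure (distr lborel borel ((*) (cis (- t)))) (U i)"
      by (simp add: lborel_distr_rotation)
    ultimately show ?thesis by (subst (asm) measure_distr) auto
  qed
  have UN: "(\<Union>i<n. U i) = {z. norm z \<le> d \<and> norm z \<in> A} - {0}"
    using sector_less[OF n] by (auto simp: U_def)
  have sub: "emeasure lborel S \<noteq> \<infinity>" if "S \<subseteq> cball 0 d" for S :: "complex set"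
    using emeasure_mono[OF that, of lborel] d by (auto simp: emeasure_disk top_unique)
  have "real n * measure lborel (U 0) = (\<Sum>i<n. measure lborel (U i))"
    by (subst sum.cong[OF refl rot]) auto
  also have "\<dots> = measure lborel (\<Union>i<n. U i)"
  proof (rule measure_finite_Union[symmetric])
    show "disjoint_family_on U {..<n}" by (auto simp: disjoint_family_on_def U_def)
    show "emeasure lborel (U i) \<noteq> \<infinity>" for i by (rule sub) (auto simp: U_def)
  qed auto
  also have "\<dots> = measure lborel {z::complex. norm z \<le> d \<and> norm z \<in> A}"
    unfolding UN by (rule measure_eq_AE) (auto intro!: AE_I[of _ _ "{0}"])
  also have "\<dots> = pi * d\<^sup>2 * measure (radial d) A"
    using d by (simp add: measure_radial)
  finally have U0: "measure lborel (U 0) = pi * d\<^sup>2 / real n * measure (radial d) A"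
    using n by (simp add: field_simps)
  have [measurable]: "(\<lambda>p. sector n c p = j) \<in> measurable borel (count_space UNIV)"
    by measurable
  have V: "{p \<in> cball c d. dist p c \<in> A \<and> sector n c p = j} \<in> sets borel" (is "?V \<in> _")
    unfolding mem_cball by measurable
  \<comment> \<open>Translation by \<open>c\<close> moves the problem to the origin. The two sets
    then differ at most in the origin itself.\<close>
  have "measure lborel ?V = measure (distr lborel borel ((+) c)) ?V"
    by (simp add: lborel_distr_plus)
  also have "\<dots> = measure lborel ((+) c -` ?V \<inter> space lborel)"
    using V by (subst measure_distr) auto
  also have "\<dots> = measure lborel (U j)"
    by (rule measure_eq_AE)
      (auto intro!: AE_I[of _ _ "{0}"] measurable_sets[OF _ V] simp: U_def dist_norm sector_def
        simp del: measurable_lborel1 intro: measurable_sets_borel[OF _ V])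
  finally show ?thesis using U0 rot[OF j] by simp
qed

section \<open>Range vectors from an ordered partition of the disk\<close>

text \<open>The labelling \<open>f\<close> stays abstract because it is used twice: with
  \<open>sector\<close> to compute probabilities and with \<open>grid\<close> to prove
  measurability. \<open>Q\<close> is the set of labels that are to carry a landmark.\<close>

definition slot ::
  "real \<Rightarrow> complex \<Rightarrow> (complex \<Rightarrow> nat) \<Rightarrow> (nat \<Rightarrow> real set) \<Rightarrow> nat set \<Rightarrow> nat \<Rightarrow> complex set" where
  "slot d c f A Q i = {p \<in> cball c d. dist p c \<in> A i \<and> f p = sorted_list_of_set Q ! i}"

text \<open>The extra cell with index \<open>card Q\<close> is the part of the disk outside all
  slots. With it the cells partition the disk, which gives disjoint sets for the independence of
  counts and a total area that does not depend on \<open>A\<close> or \<open>Q\<close>.\<close>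

definition cells ::
  "real \<Rightarrow> complex \<Rightarrow> (complex \<Rightarrow> nat) \<Rightarrow> (nat \<Rightarrow> real set) \<Rightarrow> nat set \<Rightarrow> nat \<Rightarrow> complex set" where
  "cells d c f A Q i =
    (if i < card Q then slot d c f A Q i else cball c d - (\<Union>j<card Q. slot d c f A Q j))"

text \<open>A condition on finitely many counts, the form of event to which
  \<open>poisson_pp\<close> and \<open>indep_pp\<close> apply directly.\<close>

definition occupied ::
  "real \<Rightarrow> complex \<Rightarrow> (complex \<Rightarrow> nat) \<Rightarrow> (nat \<Rightarrow> real set) \<Rightarrow> nat set \<Rightarrow> complex set \<Rightarrow> bool" where
  "occupied d c f A Q P \<longleftrightarrow>
    (\<forall>i<Suc (card Q). pcount P (cells d c f A Q i) = (if i < card Q then 1 else 0))"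

definition order_compatible :: "real \<Rightarrow> complex \<Rightarrow> (complex \<Rightarrow> nat) \<Rightarrow> complex set \<Rightarrow> bool" where
  "order_compatible d c f P \<longleftrightarrow> inj_on f (P \<inter> cball c d) \<and>
    (\<forall>p\<in>P \<inter> cball c d. \<forall>q\<in>P \<inter> cball c d. f p < f q \<longrightarrow>
      lex_less (bearing (p - c), dist p c) (bearing (q - c), dist q c))"

definition ranges_in :: "real \<Rightarrow> complex \<Rightarrow> nat \<Rightarrow> (nat \<Rightarrow> real set) \<Rightarrow> complex set \<Rightarrow> bool" where
  "ranges_in d c k A P \<longleftrightarrow>
    length (range_vec d c P) = k \<and> (\<forall>i<k. range_vec d c P ! i \<in> A i)"

text \<open>Serves to prove that a strictly sorted list is determined by its set, so that the
  definite description in \<open>range_vec\<close> has a unique solution.\<close>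

lemma lex_less_linorder: "class.linorder (\<lambda>p q. p = q \<or> lex_less p q) lex_less"
  by unfold_locales (auto simp: lex_less_def prod_eq_iff)

lemma sorted_list_of_set_nth_less:
  "finite Q \<Longrightarrow> i < j \<Longrightarrow> j < card Q \<Longrightarrow> sorted_list_of_set Q ! i < sorted_list_of_set Q ! j"
  using sorted_wrt_nth_less[OF strict_sorted_list_of_set, of i j Q] by simp

lemma sorted_list_of_set_nth_in:
  "finite Q \<Longrightarrow> i < card Q \<Longrightarrow> sorted_list_of_set Q ! i \<in> Q"
  by (metis nth_mem set_sorted_list_of_set length_sorted_list_of_set)

lemma sorted_list_of_set_nth_image:
  "finite Q \<Longrightarrow> (\<lambda>i. sorted_list_of_set Q ! i) ` {..<card Q} = Q"
  using nth_image[of "card Q" "sorted_list_of_set Q"] by (simp add: lessThan_atLeast0)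

text \<open>The visible landmark with the \<open>i\<close>-th smallest label, counting from 0. It is
  meaningful when \<open>f\<close> is injective on the visible landmarks.\<close>

definition nth_landmark ::
  "real \<Rightarrow> complex \<Rightarrow> (complex \<Rightarrow> nat) \<Rightarrow> complex set \<Rightarrow> nat \<Rightarrow> complex" where
  "nth_landmark d c f P i =
    the_inv_into (P \<inter> cball c d) f (sorted_list_of_set (f ` (P \<inter> cball c d)) ! i)"

lemma nth_landmark:
  assumes fin: "finite (P \<inter> cball c d)" and inj: "inj_on f (P \<inter> cball c d)"
  shows "i < card (P \<inter> cball c d) \<Longrightarrow> nth_landmark d c f P i \<in> P \<inter> cball c d"
    and "i < card (P \<inter> cball c d) \<Longrightarrow>
      f (nth_landmark d c f P i) = sorted_list_of_set (f ` (P \<inter> cball c d)) ! i"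
    and "nth_landmark d c f P ` {..<card (P \<inter> cball c d)} = P \<inter> cball c d"
proof -
  let ?S = "P \<inter> cball c d"
  let ?Q = "f ` ?S"
  have cQ: "card ?Q = card ?S" by (rule card_image[OF inj])
  have finQ: "finite ?Q" using fin by simp
  have Q: "sorted_list_of_set ?Q ! i \<in> ?Q" if "i < card ?S" for i
    by (rule sorted_list_of_set_nth_in[OF finQ]) (simp only: cQ that)
  show "nth_landmark d c f P i \<in> ?S" if "i < card ?S"
    unfolding nth_landmark_def by (rule the_inv_into_into[OF inj Q[OF that] subset_refl])
  show "f (nth_landmark d c f P i) = sorted_list_of_set ?Q ! i" if "i < card ?S"
    unfolding nth_landmark_def by (rule f_the_inv_into_f[OF inj Q[OF that]])
  have "nth_landmark d c f P ` {..<card ?S}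
      = the_inv_into ?S f ` (\<lambda>i. sorted_list_of_set ?Q ! i) ` {..<card ?Q}"
    by (simp add: image_image nth_landmark_def cQ)
  also have "\<dots> = the_inv_into ?S f ` ?Q"
    using finQ by (subst sorted_list_of_set_nth_image) auto
  also have "\<dots> = ?S"
    using inj by (rule the_inv_into_onto)
  finally show "nth_landmark d c f P ` {..<card ?S} = ?S" .
qed

text \<open>Listing the landmarks by increasing label yields a list strictly sorted by bearing and
  distance. Such a list is unique, so it is the one selected in \<open>range_vec\<close>.\<close>

lemma range_vec_eq:
  assumes fin: "finite (P \<inter> cball c d)" and oc: "order_compatible d c f P"
  shows "range_vec d c P = map (\<lambda>i. dist (nth_landmark d c f P i) c) [0..<card (P \<inter> cball c d)]"
proof -
  let ?S = "P \<inter> cball c d" and ?key = "\<lambda>p. (bearing (p - c), dist p c)"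
  let ?Q = "f ` ?S"
  define g where "g = nth_landmark d c f P"
  define xs where "xs = map (\<lambda>i. ?key (g i)) [0..<card ?S]"
  have inj: "inj_on f ?S" using oc by (simp add: order_compatible_def)
  have cQ: "card ?Q = card ?S" by (rule card_image[OF inj])
  have finQ: "finite ?Q" using fin by simp
  note gS = nth_landmark(1)[OF fin inj, folded g_def] and fg = nth_landmark(2)[OF fin inj, folded g_def]
  have "sorted_wrt lex_less xs"
    unfolding sorted_wrt_iff_nth_less
  proof (intro allI impI)
    fix i j assume ij: "i < j" "j < length xs"
    then have "f (g i) < f (g j)"
      using sorted_list_of_set_nth_less[OF finQ, of i j] by (simp add: fg xs_def cQ)
    then have "lex_less (?key (g i)) (?key (g j))"
      using oc gS[of i] gS[of j] ij unfolding order_compatible_def by (auto simp: xs_def)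
    then show "lex_less (xs ! i) (xs ! j)"
      using ij by (simp add: xs_def)
  qed
  moreover have "g ` {..<card ?S} = ?S"
    unfolding g_def by (rule nth_landmark(3)[OF fin inj])
  then have "?key ` ?S = ?key ` g ` {..<card ?S}" by (simp only:)
  then have "set xs = ?key ` ?S"
    by (simp add: xs_def image_image atLeast0LessThan)
  ultimately have "(THE xs. set xs = ?key ` ?S \<and> sorted_wrt lex_less xs) = xs"
    by (intro the_equality conjI) (auto intro: linorder.strict_sorted_equal[OF lex_less_linorder])
  then show ?thesis
    by (simp add: range_vec_def xs_def g_def o_def)
qed

lemma slot_subset: "slot d c f A Q i \<subseteq> cball c d"
  by (auto simp: slot_def)

lemma slot_disjoint:
  assumes "finite Q" "i < card Q" "j < card Q" "i \<noteq> j"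
  shows "slot d c f A Q i \<inter> slot d c f B Q j = {}"
proof -
  have "sorted_list_of_set Q ! i \<noteq> sorted_list_of_set Q ! j"
    using assms by (simp add: nth_eq_iff_index_eq)
  then show ?thesis by (auto simp: slot_def)
qed

text \<open>One landmark in every slot and none in the remaining cell means that the slots
  themselves enumerate the visible landmarks, \<open>g i\<close> being the landmark in slot
  \<open>i\<close>.\<close>

lemma occupied_iff:
  assumes fin: "finite (P \<inter> cball c d)" and Q: "finite Q"
  shows "occupied d c f A Q P \<longleftrightarrow>
    (\<exists>g. (\<forall>i<card Q. g i \<in> slot d c f A Q i) \<and> P \<inter> cball c d = g ` {..<card Q})"
proof
  assume L: "occupied d c f A Q P"
  have "\<exists>p. P \<inter> slot d c f A Q i = {p}" if "i < card Q" for i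
    using L[unfolded occupied_def, rule_format, of i] that
    by (auto simp: pcount_def cells_def card_1_singleton_iff)
  then obtain g where g: "\<And>i. i < card Q \<Longrightarrow> P \<inter> slot d c f A Q i = {g i}"
    by metis
  have "card (P \<inter> (cball c d - (\<Union>j<card Q. slot d c f A Q j))) = 0"
    using L[unfolded occupied_def, rule_format, of "card Q"] by (simp add: pcount_def cells_def)
  moreover have "finite (P \<inter> (cball c d - (\<Union>j<card Q. slot d c f A Q j)))"
    by (rule finite_subset[OF _ fin]) auto
  ultimately have "P \<inter> (cball c d - (\<Union>j<card Q. slot d c f A Q j)) = {}" by (simp only: card_0_eq)
  moreover have "(\<Union>j<card Q. slot d c f A Q j) \<subseteq> cball c d"
    using slot_subset by (intro UN_least)
  ultimately have "P \<inter> cball c d = P \<inter> (\<Union>j<card Q. slot d c f A Q j)" by blast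
  also have "\<dots> = (\<Union>j<card Q. P \<inter> slot d c f A Q j)" by simp
  also have "\<dots> = g ` {..<card Q}" using g by auto
  finally show "\<exists>g. (\<forall>i<card Q. g i \<in> slot d c f A Q i) \<and> P \<inter> cball c d = g ` {..<card Q}"
    using g by (intro exI[of _ g]) blast
next
  assume "\<exists>g. (\<forall>i<card Q. g i \<in> slot d c f A Q i) \<and> P \<inter> cball c d = g ` {..<card Q}"
  then obtain g where g: "\<And>i. i < card Q \<Longrightarrow> g i \<in> slot d c f A Q i"
    and P: "P \<inter> cball c d = g ` {..<card Q}" by blast
  have 1: "P \<inter> slot d c f A Q i = {g i}" if i: "i < card Q" for i
  proof -
    have "P \<inter> slot d c f A Q i = g ` {..<card Q} \<inter> slot d c f A Q i"
      using P slot_subset[of d c f A Q i] by blast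
    also have "\<dots> = {g i}"
      using g i slot_disjoint[OF Q, of _ i d c f A A] by fastforce
    finally show ?thesis .
  qed
  have 2: "P \<inter> (cball c d - (\<Union>j<card Q. slot d c f A Q j)) = {}"
    unfolding Int_Diff[symmetric] P using g by auto
  show "occupied d c f A Q P"
    unfolding occupied_def pcount_def cells_def using 1 2 by auto
qed

lemma occupied_imp:
  assumes fin: "finite (P \<inter> cball c d)" and Q: "finite Q" and o: "occupied d c f A Q P"
  shows "inj_on f (P \<inter> cball c d)" and "f ` (P \<inter> cball c d) = Q"
proof -
  obtain g where g: "\<And>i. i < card Q \<Longrightarrow> g i \<in> slot d c f A Q i"
    and P: "P \<inter> cball c d = g ` {..<card Q}"
    using o unfolding occupied_iff[OF fin Q] by blast
  have fg: "f (g i) = sorted_list_of_set Q ! i" if "i < card Q" for i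
    using g[OF that] by (simp add: slot_def)
  show "f ` (P \<inter> cball c d) = Q"
  proof -
    have "f ` (P \<inter> cball c d) = (\<lambda>i. sorted_list_of_set Q ! i) ` {..<card Q}"
      unfolding P image_image by (rule image_cong) (auto simp: fg)
    then show ?thesis by (simp only: sorted_list_of_set_nth_image[OF Q])
  qed
  show "inj_on f (P \<inter> cball c d)"
    unfolding P using Q by (auto intro!: inj_onI simp: fg nth_eq_iff_index_eq)
qed

text \<open>The only candidate for \<open>Q\<close> is the set of labels in use. For that
  \<open>Q\<close> the landmark in slot \<open>i\<close> is the \<open>i\<close>-th one in bearing
  order, so the slot conditions become conditions on the entries of the range vector.\<close>

lemma occupied_iff_ranges_in:
  assumes fin: "finite (P \<inter> cball c d)" and oc: "order_compatible d c f P"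
  shows "(finite Q \<and> occupied d c f A Q P) \<longleftrightarrow>
    Q = f ` (P \<inter> cball c d) \<and> ranges_in d c (card Q) A P"
proof -
  let ?S = "P \<inter> cball c d"
  let ?Q = "f ` ?S"
  define g where "g = nth_landmark d c f P"
  have inj: "inj_on f ?S" using oc by (simp add: order_compatible_def)
  have cQ: "card ?Q = card ?S" by (rule card_image[OF inj])
  have finQ: "finite ?Q" using fin by simp
  note gS = nth_landmark(1)[OF fin inj, folded g_def] and fg = nth_landmark(2)[OF fin inj, folded g_def]
  have img: "?S = g ` {..<card ?S}"
    unfolding g_def by (rule nth_landmark(3)[OF fin inj, symmetric])
  have R: "range_vec d c P = map (\<lambda>i. dist (g i) c) [0..<card ?S]"
    unfolding g_def by (rule range_vec_eq[OF fin oc])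
  have main: "occupied d c f A ?Q P \<longleftrightarrow> (\<forall>i<card ?S. dist (g i) c \<in> A i)"
  proof
    assume o: "occupied d c f A ?Q P"
    then obtain h where h: "\<And>i. i < card ?S \<Longrightarrow> h i \<in> slot d c f A ?Q i"
      and P: "?S = h ` {..<card ?S}"
      unfolding occupied_iff[OF fin finQ] cQ by blast
    \<comment> \<open>Both landmarks carry the \<open>i\<close>-th label of \<open>?Q\<close>, and
      labels are injective on the visible landmarks.\<close>
    have "h i = g i" if i: "i < card ?S" for i
    proof (rule inj_onD[OF inj])
      show "f (h i) = f (g i)" using h[OF i] i by (simp add: slot_def fg)
      show "h i \<in> ?S" by (subst P) (use i in auto)
      show "g i \<in> ?S" by (rule gS[OF i])
    qed
    then show "\<forall>i<card ?S. dist (g i) c \<in> A i" using h by (auto simp: slot_def)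
  next
    assume "\<forall>i<card ?S. dist (g i) c \<in> A i"
    then have "\<forall>i<card ?S. g i \<in> slot d c f A ?Q i"
      using gS fg by (auto simp: slot_def)
    then show "occupied d c f A ?Q P"
      unfolding occupied_iff[OF fin finQ] cQ using img by blast
  qed
  moreover have "ranges_in d c (card ?Q) A P \<longleftrightarrow> (\<forall>i<card ?S. dist (g i) c \<in> A i)"
    by (simp add: ranges_in_def R cQ)
  ultimately show ?thesis
    using occupied_imp(2)[OF fin, of Q f A] finQ by metis
qed

lemma ex_occupied_iff_ranges_in:
  assumes fin: "finite (P \<inter> cball c d)" and oc: "order_compatible d c f P"
    and f: "\<And>p. p \<in> cball c d \<Longrightarrow> f p < n"
  shows "(\<exists>Q\<subseteq>{..<n}. card Q = k \<and> occupied d c f A Q P) \<longleftrightarrow> ranges_in d c k A P"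
proof
  assume "\<exists>Q\<subseteq>{..<n}. card Q = k \<and> occupied d c f A Q P"
  then show "ranges_in d c k A P"
    using occupied_iff_ranges_in[OF fin oc] finite_subset[OF _ finite_lessThan[of n]] by metis
next
  assume r: "ranges_in d c k A P"
  let ?Q = "f ` (P \<inter> cball c d)"
  have "k = card ?Q"
    using r range_vec_eq[OF fin oc] oc by (simp add: ranges_in_def card_image order_compatible_def)
  then have "occupied d c f A ?Q P"
    using occupied_iff_ranges_in[OF fin oc, of ?Q A] r by simp
  then show "\<exists>Q\<subseteq>{..<n}. card Q = k \<and> occupied d c f A Q P"
    using f \<open>k = card ?Q\<close> by (intro exI[of _ ?Q]) auto
qed

section \<open>Measurability\<close>

text \<open>A two-digit number in base \<open>n\<close>: the sector is the leading digit, the radial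
  level the trailing one. Dividing by \<open>2 * d\<close> rather than \<open>d\<close> keeps the
  radial level below \<open>n\<close> even on the boundary circle.\<close>

definition grid :: "real \<Rightarrow> nat \<Rightarrow> complex \<Rightarrow> complex \<Rightarrow> nat" where
  "grid d n c p = sector n c p * n + nat \<lfloor>real n * (dist p c / (2 * d))\<rfloor>"

lemma grid_less:
  assumes d: "d > 0" and n: "n > 0" and p: "p \<in> cball c d"
  shows "nat \<lfloor>real n * (dist p c / (2 * d))\<rfloor> < n" and "grid d n c p < n * n"
proof -
  have "dist p c / (2 * d) < 1"
    using d p by (simp add: field_simps dist_commute)
  then have "real n * (dist p c / (2 * d)) < real n"
    using n mult_strict_left_mono[of "dist p c / (2 * d)" 1 "real n"] by simp
  then show *: "nat \<lfloor>real n * (dist p c / (2 * d))\<rfloor> < n"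
    using n by linarith
  have "Suc (sector n c p) * n \<le> n * n"
    using sector_less[OF n, of c p] by (intro mult_right_mono) auto
  then show "grid d n c p < n * n"
    using * by (simp add: grid_def)
qed

lemma measurable_grid [measurable]: "grid d n c \<in> measurable borel (count_space UNIV)"
  unfolding grid_def[abs_def] by measurable

text \<open>As soon as \<open>n * (y - x)\<close> is at least 1, an integer separates the two scaled
  numbers.\<close>

lemma eventually_floor_less:
  assumes "0 \<le> x" "x < y"
  shows "\<forall>\<^sub>F n::nat in sequentially. nat \<lfloor>real n * x\<rfloor> < nat \<lfloor>real n * y\<rfloor>"
proof -
  obtain N :: nat where N: "1 / (y - x) < real N" using reals_Archimedean2 by blast
  have "nat \<lfloor>real n * x\<rfloor> < nat \<lfloor>real n * y\<rfloor>" if "n \<ge> N" for n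
  proof -
    have "1 / (y - x) \<le> real n" using N that by linarith
    then have "1 \<le> real n * (y - x)" using assms by (simp add: field_simps)
    then have "real n * x + 1 \<le> real n * y" by (simp add: algebra_simps)
    then have "\<lfloor>real n * x\<rfloor> < \<lfloor>real n * y\<rfloor>" by linarith
    moreover have "0 \<le> \<lfloor>real n * x\<rfloor>" using assms by simp
    ultimately show ?thesis by linarith
  qed
  then show ?thesis by (rule eventually_sequentiallyI)
qed

text \<open>Different bearings are eventually separated by the leading digit. Equal bearings have
  the same leading digit for every \<open>n\<close>, and then the distances are eventually separated
  by the trailing one.\<close>

lemma eventually_grid_less:
  assumes d: "d > 0" and p: "p \<in> cball c d" and q: "q \<in> cball c d"
    and l: "lex_less (bearing (p - c), dist p c) (bearing (q - c), dist q c)"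
  shows "\<forall>\<^sub>F n in sequentially. grid d n c p < grid d n c q"
proof (cases "bearing (p - c) < bearing (q - c)")
  case True
  have "\<forall>\<^sub>F n::nat in sequentially. nat \<lfloor>real n * (bearing (p - c) / (2 * pi))\<rfloor>
      < nat \<lfloor>real n * (bearing (q - c) / (2 * pi))\<rfloor>"
    using True bearing_bounds by (intro eventually_floor_less) (auto simp: divide_strict_right_mono)
  then show ?thesis
  proof (eventually_elim)
    case (elim n)
    then have s: "sector n c p < sector n c q" by (simp add: sector_def)
    \<comment> \<open>For \<open>n = 0\<close> both sector numbers would be 0.\<close>
    then have n: "n > 0" by (auto simp: sector_def intro: gr0I)
    have "grid d n c p < Suc (sector n c p) * n"
      using grid_less(1)[OF d n p] by (simp add: grid_def)
    also have "\<dots> \<le> sector n c q * n"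
      using s by (intro mult_right_mono) auto
    finally show ?case by (simp add: grid_def)
  qed
next
  case False
  with l have b: "bearing (p - c) = bearing (q - c)" and r: "dist p c < dist q c"
    by (auto simp: lex_less_def)
  have "\<forall>\<^sub>F n::nat in sequentially. nat \<lfloor>real n * (dist p c / (2 * d))\<rfloor>
      < nat \<lfloor>real n * (dist q c / (2 * d))\<rfloor>"
    using r d by (intro eventually_floor_less) (auto simp: divide_strict_right_mono)
  then show ?thesis
    by eventually_elim (simp add: grid_def sector_def b)
qed

text \<open>Bearing and distance determine a point, so two distinct landmarks are strictly ordered
  and the grid eventually reproduces their order. Finitely many pairs allow a common threshold,
  which depends on the configuration.\<close>

lemma eventually_order_compatible_grid:
  assumes d: "d > 0" and fin: "finite (P \<inter> cball c d)"
  shows "\<forall>\<^sub>F n in sequentially. order_compatible d c (grid d n c) P"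
proof -
  let ?S = "P \<inter> cball c d" and ?key = "\<lambda>p. (bearing (p - c), dist p c)"
  have pair: "\<forall>\<^sub>F n in sequentially. (grid d n c p = grid d n c q \<longrightarrow> p = q) \<and>
      (grid d n c p < grid d n c q \<longrightarrow> lex_less (?key p) (?key q))"
    if p: "p \<in> ?S" and q: "q \<in> ?S" for p q
  proof (cases "p = q")
    case False
    then have "?key p \<noteq> ?key q"
      using bearing_norm_inj[of "p - c" "q - c"] by (auto simp: dist_norm)
    then have "lex_less (?key p) (?key q) \<or> lex_less (?key q) (?key p)"
      by (simp add: lex_less_def) linarith
    then consider "lex_less (?key p) (?key q)" | "lex_less (?key q) (?key p)"
      by blast
    then show ?thesis
    proof cases
      case 1
      have "\<forall>\<^sub>F n in sequentially. grid d n c p < grid d n c q"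
        using eventually_grid_less[OF d _ _ 1] p q by simp
      then show ?thesis by eventually_elim (use 1 in auto)
    next
      case 2
      have "\<forall>\<^sub>F n in sequentially. grid d n c q < grid d n c p"
        using eventually_grid_less[OF d _ _ 2] p q by simp
      then show ?thesis by eventually_elim auto
    qed
  qed auto
  have "\<forall>\<^sub>F n in sequentially. \<forall>p\<in>?S. \<forall>q\<in>?S. (grid d n c p = grid d n c q \<longrightarrow> p = q) \<and>
      (grid d n c p < grid d n c q \<longrightarrow> lex_less (?key p) (?key q))"
    using pair fin by (intro eventually_ball_finite ballI) auto
  then show ?thesis
    by eventually_elim (auto simp: order_compatible_def inj_on_def)
qed

text \<open>Sector numbers are monotone in the bearing, so a smaller number forces a strictly
  smaller bearing. Only landmarks sharing a sector could spoil the order.\<close>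

lemma order_compatible_sector:
  assumes "inj_on (sector n c) (P \<inter> cball c d)"
  shows "order_compatible d c (sector n c) P"
proof -
  have "bearing (p - c) < bearing (q - c)" if "sector n c p < sector n c q" for p q
  proof (rule ccontr)
    assume "\<not> ?thesis"
    then have "real n * bearing (q - c) / (2 * pi) \<le> real n * bearing (p - c) / (2 * pi)"
      by (intro divide_right_mono mult_left_mono) auto
    then have "sector n c q \<le> sector n c p"
      unfolding sector_def by (intro nat_mono floor_mono)
    then show False using that by simp
  qed
  then show ?thesis using assms by (auto simp: order_compatible_def lex_less_def)
qed

lemma cells_borel:
  assumes [measurable]: "f \<in> measurable borel (count_space UNIV)" "\<And>i. i < card Q \<Longrightarrow> A i \<in> sets borel"
  shows "cells d c f A Q i \<in> sets borel" and "bounded (cells d c f A Q i)"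
proof -
  have sl: "slot d c f A Q j \<in> sets borel" if "j < card Q" for j
  proof -
    have [measurable]: "A j \<in> sets borel" using assms(2)[OF that] .
    show ?thesis unfolding slot_def mem_cball by measurable
  qed
  then show "cells d c f A Q i \<in> sets borel" by (auto simp: cells_def)
  have "cells d c f A Q i \<subseteq> cball c d" by (auto simp: cells_def slot_def)
  then show "bounded (cells d c f A Q i)" using bounded_cball bounded_subset by blast
qed

lemma poisson_ppD:
  assumes "poisson_pp M Phi lam" "B \<in> sets borel" "bounded B"
  shows "\<And>\<omega>. \<omega> \<in> space M \<Longrightarrow> finite (Phi \<omega> \<inter> B)"
    and "(\<lambda>\<omega>. pcount (Phi \<omega>) B) \<in> measurable M (count_space UNIV)"
    and "measure M {\<omega> \<in> space M. pcount (Phi \<omega>) B = k}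
      = (lam * measure lborel B) ^ k / fact k * exp (- (lam * measure lborel B))"
  using assms unfolding poisson_pp_def by auto

lemma measurable_occupied:
  assumes "poisson_pp M Phi lam" "f \<in> measurable borel (count_space UNIV)"
    "\<And>i. i < card Q \<Longrightarrow> A i \<in> sets borel"
  shows "Measurable.pred M (\<lambda>\<omega>. occupied d c f A Q (Phi \<omega>))"
proof -
  have [measurable]: "(\<lambda>\<omega>. pcount (Phi \<omega>) (cells d c f A Q i)) \<in> measurable M (count_space UNIV)" for i
    using assms cells_borel by (intro poisson_ppD(2)) auto
  show ?thesis unfolding occupied_def by measurable
qed

text \<open>For each outcome the grid events agree with the event in question once the mesh is fine
  enough. The event is therefore exactly the limit inferior of a sequence of measurable events, with
  no exceptional null set.\<close>

lemma measurable_ranges_in: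
  assumes pp: "poisson_pp M Phi lam" and d: "d > 0" and A: "\<And>i. i < k \<Longrightarrow> A i \<in> sets borel"
  shows "Measurable.pred M (\<lambda>\<omega>. ranges_in d c k A (Phi \<omega>))"
proof -
  have [measurable]: "Measurable.pred M
      (\<lambda>\<omega>. \<exists>Q\<in>{Q. Q \<subseteq> {..<n * n} \<and> card Q = k}. occupied d c (grid d n c) A Q (Phi \<omega>))" for n
    by (intro pred_intros_finite measurable_occupied[OF pp]) (use A in auto)
  have "Measurable.pred M (\<lambda>\<omega>. \<forall>\<^sub>F n in sequentially.
      \<exists>Q\<in>{Q. Q \<subseteq> {..<n * n} \<and> card Q = k}. occupied d c (grid d n c) A Q (Phi \<omega>))"
    unfolding eventually_sequentially by measurable
  moreover have "(\<forall>\<^sub>F n in sequentially.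
      \<exists>Q\<in>{Q. Q \<subseteq> {..<n * n} \<and> card Q = k}. occupied d c (grid d n c) A Q (Phi \<omega>))
    \<longleftrightarrow> ranges_in d c k A (Phi \<omega>)" if "\<omega> \<in> space M" for \<omega>
  proof -
    have fin: "finite (Phi \<omega> \<inter> cball c d)"
      by (rule poisson_ppD(1)[OF pp _ _ that]) auto
    have "\<forall>\<^sub>F n in sequentially. (\<exists>Q\<in>{Q. Q \<subseteq> {..<n * n} \<and> card Q = k}.
        occupied d c (grid d n c) A Q (Phi \<omega>)) = ranges_in d c k A (Phi \<omega>)"
      using eventually_order_compatible_grid[OF d fin] eventually_gt_at_top[of 0]
    proof eventually_elim
      case (elim n)
      show ?case
        using ex_occupied_iff_ranges_in[OF fin elim(1), of "n * n" k A] grid_less(2)[OF d elim(2)]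
        by auto
    qed
    then have "(\<forall>\<^sub>F n in sequentially. \<exists>Q\<in>{Q. Q \<subseteq> {..<n * n} \<and> card Q = k}.
        occupied d c (grid d n c) A Q (Phi \<omega>))
      \<longleftrightarrow> (\<forall>\<^sub>F n::nat in sequentially. ranges_in d c k A (Phi \<omega>))"
      by (rule eventually_cong) auto
    then show ?thesis by simp
  qed
  ultimately show ?thesis by (simp cong: measurable_cong)
qed

section \<open>Joint law of the two range vectors\<close>

text \<open>The counts of the disjoint cells are independent Poisson variables. Their exponential
  factors combine to that of the whole disk; each slot contributes its mean besides, and the
  remaining cell contributes nothing more.\<close>

lemma (in prob_space) prob_occupied:
  assumes pp: "poisson_pp M Phi lam" and d: "d > 0" and n: "n > 0" and Q: "Q \<subseteq> {..<n}"
    and A: "\<And>i. i < card Q \<Longrightarrow> A i \<in> sets borel"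
  shows "prob {\<omega> \<in> space M. occupied d c (sector n c) A Q (Phi \<omega>)}
    = exp (- (lam * pi * d\<^sup>2)) *
      (\<Prod>i<card Q. lam * pi * d\<^sup>2 / real n * measure (radial d) (A i))"
proof -
  let ?C = "cells d c (sector n c) A Q" and ?k = "card Q"
  let ?a = "\<lambda>i. if i < ?k then 1 else 0 :: nat"
  have finQ: "finite Q" using Q finite_subset by blast
  have C: "?C i \<in> sets borel" "bounded (?C i)" for i
    using A by (auto intro!: cells_borel)
  have slotC: "?C i = slot d c (sector n c) A Q i" if "i < ?k" for i
    using that by (simp add: cells_def)
  have disj: "disjoint_family_on ?C {..<Suc ?k}"
    unfolding disjoint_family_on_def
  proof (intro ballI impI)
    fix i j assume ij: "i \<in> {..<Suc ?k}" "j \<in> {..<Suc ?k}" "i \<noteq> j"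
    show "?C i \<inter> ?C j = {}"
      using slot_disjoint[OF finQ _ _ ij(3), of d c "sector n c" A A] ij
      by (auto simp: cells_def)
  qed
  have ind: "indep_vars (\<lambda>_. count_space UNIV) (\<lambda>i \<omega>. pcount (Phi \<omega>) (?C i)) {..<Suc ?k}"
    by (rule pp[unfolded poisson_pp_def, THEN conjunct2, rule_format]) (use disj C in auto)
  have "{\<omega> \<in> space M. occupied d c (sector n c) A Q (Phi \<omega>)}
      = (\<Inter>i\<in>{..<Suc ?k}. (\<lambda>\<omega>. pcount (Phi \<omega>) (?C i)) -` {?a i} \<inter> space M)"
    unfolding occupied_def by auto
  then have "prob {\<omega> \<in> space M. occupied d c (sector n c) A Q (Phi \<omega>)}
      = (\<Prod>i<Suc ?k. prob ((\<lambda>\<omega>. pcount (Phi \<omega>) (?C i)) -` {?a i} \<inter> space M))"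
    by (simp only:) (rule indep_varsD_finite[OF ind], auto)
  also have "\<dots> = (\<Prod>i<Suc ?k. (lam * measure lborel (?C i)) ^ ?a i / fact (?a i)
      * exp (- (lam * measure lborel (?C i))))"
  proof (rule prod.cong[OF refl])
    fix i
    have "(\<lambda>\<omega>. pcount (Phi \<omega>) (?C i)) -` {?a i} \<inter> space M
        = {\<omega> \<in> space M. pcount (Phi \<omega>) (?C i) = ?a i}" by auto
    then show "prob ((\<lambda>\<omega>. pcount (Phi \<omega>) (?C i)) -` {?a i} \<inter> space M)
        = (lam * measure lborel (?C i)) ^ ?a i / fact (?a i) * exp (- (lam * measure lborel (?C i)))"
      using poisson_ppD(3)[OF pp C] by simp
  qed
  also have "\<dots> = (\<Prod>i<Suc ?k. (lam * measure lborel (?C i)) ^ ?a i / fact (?a i))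
      * (\<Prod>i<Suc ?k. exp (- (lam * measure lborel (?C i))))"
    by (rule prod.distrib)
  also have "(\<Prod>i<Suc ?k. exp (- (lam * measure lborel (?C i))))
      = exp (- (lam * (\<Sum>i<Suc ?k. measure lborel (?C i))))"
    by (subst exp_sum[symmetric]) (simp_all only: sum_negf sum_distrib_left finite_lessThan)
  also have "(\<Sum>i<Suc ?k. measure lborel (?C i)) = measure lborel (\<Union>i<Suc ?k. ?C i)"
  proof (rule measure_finite_Union[symmetric])
    show "emeasure lborel (?C i) \<noteq> \<infinity>" for i
      using emeasure_bounded_finite[OF C(2)[of i]] by simp
  qed (use disj C in auto)
  also have "(\<Union>i<Suc ?k. ?C i) = cball c d"
    using slot_subset[of d c "sector n c" A Q] by (auto simp: cells_def lessThan_Suc)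
  also have "(\<Prod>i<Suc ?k. (lam * measure lborel (?C i)) ^ ?a i / fact (?a i))
      = (\<Prod>i<?k. lam * measure lborel (?C i))"
    by simp
  also have "\<dots> = (\<Prod>i<?k. lam * pi * d\<^sup>2 / real n * measure (radial d) (A i))"
  proof (rule prod.cong[OF refl])
    fix i assume "i \<in> {..<?k}"
    then have i: "i < ?k" by simp
    have "sorted_list_of_set Q ! i < n"
      using sorted_list_of_set_nth_in[OF finQ i] Q by auto
    then show "lam * measure lborel (?C i) = lam * pi * d\<^sup>2 / real n * measure (radial d) (A i)"
      using measure_sector_annulus[OF d n _ A[OF i], of _ c] i by (simp add: slotC slot_def)
  qed
  finally show ?thesis
    using d by (simp add: measure_disk mult.assoc)
qed

text \<open>Each event fixes the value of one count vector, so \<open>indep_pp\<close> factorizes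
  their conjunction. That definition pairs vectors of equal length, which is where
  \<open>card Q = card Q'\<close> enters.\<close>

lemma (in prob_space) prob_occupied_both:
  assumes ind: "indep_pp M Phi Psi"
    and f: "f \<in> measurable borel (count_space UNIV)" and g: "g \<in> measurable borel (count_space UNIV)"
    and A: "\<And>i. i < card Q \<Longrightarrow> A i \<in> sets borel" and B: "\<And>i. i < card Q' \<Longrightarrow> B i \<in> sets borel"
    and card: "card Q = card Q'"
  shows "prob {\<omega> \<in> space M. occupied d c f A Q (Phi \<omega>) \<and> occupied d' c' g B Q' (Psi \<omega>)}
    = prob {\<omega> \<in> space M. occupied d c f A Q (Phi \<omega>)} *
      prob {\<omega> \<in> space M. occupied d' c' g B Q' (Psi \<omega>)}"
proof -
  let ?I = "{..<Suc (card Q)}" and ?a = "\<lambda>i. if i < card Q then 1 else 0 :: nat"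
  let ?N = "PiM ?I (\<lambda>_. count_space (UNIV::nat set))"
  let ?X = "\<lambda>\<omega>. \<lambda>i\<in>?I. pcount (Phi \<omega>) (cells d c f A Q i)"
  let ?Y = "\<lambda>\<omega>. \<lambda>i\<in>?I. pcount (Psi \<omega>) (cells d' c' g B Q' i)"
  let ?S = "PiE ?I (\<lambda>i. {?a i})"
  have iv: "indep_var ?N ?X ?N ?Y"
    by (rule ind[unfolded indep_pp_def, rule_format]) (use cells_borel[OF f A] cells_borel[OF g B] in auto)
  have S: "?S \<in> sets ?N" by (rule sets_PiM_I_finite) auto
  have X: "?X -` ?S \<inter> space M = {\<omega> \<in> space M. occupied d c f A Q (Phi \<omega>)}"
    by (simp only: set_eq_iff vimage_eq Int_iff mem_Collect_eq restrict_PiE_iff occupied_def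
        singleton_iff lessThan_iff Ball_def) blast
  have Y: "?Y -` ?S \<inter> space M = {\<omega> \<in> space M. occupied d' c' g B Q' (Psi \<omega>)}"
    by (simp only: set_eq_iff vimage_eq Int_iff mem_Collect_eq restrict_PiE_iff occupied_def
        singleton_iff lessThan_iff Ball_def card) blast
  have XY: "(\<lambda>\<omega>. (?X \<omega>, ?Y \<omega>)) -` (?S \<times> ?S) \<inter> space M
      = (?X -` ?S \<inter> space M) \<inter> (?Y -` ?S \<inter> space M)" by blast
  show ?thesis
    using indep_varD[OF iv S S, unfolded XY, unfolded X Y]
    by (simp only: Collect_conj_eq Int_ac Int_absorb Int_left_absorb)
qed

section \<open>Landmarks sharing a sector\<close>

text \<open>Restates the absence of shared sectors through counts, as needed for measurability and
  for the union bound.\<close>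

lemma sector_inj_iff:
  assumes "n > 0" "finite (P \<inter> cball c d)"
  shows "inj_on (sector n c) (P \<inter> cball c d) \<longleftrightarrow>
    (\<forall>j<n. pcount P {p \<in> cball c d. sector n c p = j} \<le> 1)"
proof -
  have "pcount P {p \<in> cball c d. sector n c p = j} \<le> 1 \<longleftrightarrow>
      (\<forall>p\<in>P \<inter> cball c d. \<forall>q\<in>P \<inter> cball c d. sector n c p = j \<and> sector n c q = j \<longrightarrow> p = q)" for j
  proof -
    have "finite (P \<inter> {p \<in> cball c d. sector n c p = j})"
      by (rule finite_subset[OF _ assms(2)]) auto
    then show ?thesis
      unfolding pcount_def One_nat_def by (subst card_le_Suc0_iff_eq) auto
  qed
  then show ?thesis
    using sector_less[OF assms(1), of c] by (simp only: inj_on_def) blast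
qed

lemma measurable_sector_inj:
  assumes pp: "poisson_pp M Phi lam" and n: "n > 0"
  shows "Measurable.pred M (\<lambda>\<omega>. inj_on (sector n c) (Phi \<omega> \<inter> cball c d))"
proof -
  have B: "{p \<in> cball c d. sector n c p = j} \<in> sets borel" for j
    unfolding mem_cball by measurable
  have [measurable]: "(\<lambda>\<omega>. pcount (Phi \<omega>) {p \<in> cball c d. sector n c p = j})
      \<in> measurable M (count_space UNIV)" for j
    by (rule poisson_ppD(2)[OF pp B]) (auto intro: bounded_subset[OF bounded_cball[of c d]])
  have meas: "Measurable.pred M (\<lambda>\<omega>. \<forall>j<n. pcount (Phi \<omega>) {p \<in> cball c d. sector n c p = j} \<le> 1)"
    by measurable
  have eq: "inj_on (sector n c) (Phi \<omega> \<inter> cball c d) \<longleftrightarrow>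
      (\<forall>j<n. pcount (Phi \<omega>) {p \<in> cball c d. sector n c p = j} \<le> 1)" if "\<omega> \<in> space M" for \<omega>
    by (rule sector_inj_iff[OF n poisson_ppD(1)[OF pp _ _ that]]) auto
  show ?thesis by (rule measurable_cong[THEN iffD2, OF eq meas])
qed

text \<open>A sector count is Poisson with mean \<open>a\<close>, the mean of the disk divided by
  \<open>n\<close>. It exceeds 1 with probability \<open>1 - exp (- a) * (1 + a)\<close>, which is
  at most \<open>a\<^sup>2\<close> since \<open>exp (- a)\<close> is at least \<open>1 - a\<close>.
  Summing over the \<open>n\<close> sectors gives the bound.\<close>

lemma (in prob_space) prob_not_sector_inj:
  assumes pp: "poisson_pp M Phi lam" and lam: "lam > 0" and d: "d > 0" and n: "n > 0"
  shows "prob {\<omega> \<in> space M. \<not> inj_on (sector n c) (Phi \<omega> \<inter> cball c d)} \<le> (lam * pi * d\<^sup>2)\<^sup>2 / real n"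
proof -
  define a where "a = lam * pi * d\<^sup>2 / real n"
  define D where "D j = {p \<in> cball c d. sector n c p = j}" for j
  have D: "D j \<in> sets borel" "bounded (D j)" for j
    unfolding D_def mem_cball
    by (measurable, auto intro: bounded_subset[OF bounded_cball[of c d]])
  have a: "a > 0" using lam d n by (simp add: a_def)
  have meas: "lam * measure lborel (D j) = a" if "j < n" for j
  proof -
    interpret R: prob_space "radial d" by (rule prob_space_radial[OF d])
    show ?thesis
      using measure_sector_annulus[OF d n that, of UNIV c] R.prob_space
      by (simp add: D_def a_def)
  qed
  have [measurable]: "(\<lambda>\<omega>. pcount (Phi \<omega>) (D j)) \<in> measurable M (count_space UNIV)" for j
    by (rule poisson_ppD(2)[OF pp D])
  have one: "prob {\<omega> \<in> space M. \<not> pcount (Phi \<omega>) (D j) \<le> 1} \<le> a\<^sup>2" if j: "j < n" for j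
  proof -
    have "prob {\<omega> \<in> space M. \<not> pcount (Phi \<omega>) (D j) \<le> 1}
        = 1 - prob {\<omega> \<in> space M. pcount (Phi \<omega>) (D j) \<le> 1}"
      by (rule prob_neg) measurable
    also have "{\<omega> \<in> space M. pcount (Phi \<omega>) (D j) \<le> 1}
        = {\<omega> \<in> space M. pcount (Phi \<omega>) (D j) = 0} \<union> {\<omega> \<in> space M. pcount (Phi \<omega>) (D j) = 1}"
      by auto
    also have "prob \<dots> = prob {\<omega> \<in> space M. pcount (Phi \<omega>) (D j) = 0}
        + prob {\<omega> \<in> space M. pcount (Phi \<omega>) (D j) = 1}"
      by (rule finite_measure_Union) (measurable, auto)
    also have "\<dots> = exp (- a) * (1 + a)"
      using poisson_ppD(3)[OF pp D, of j 0] poisson_ppD(3)[OF pp D, of j 1]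
      by (simp add: meas[OF j] algebra_simps)
    also have "1 - exp (- a) * (1 + a) \<le> 1 - (1 - a) * (1 + a)"
      using exp_ge_add_one_self[of "- a"] a by (intro diff_left_mono mult_right_mono) auto
    also have "\<dots> = a\<^sup>2" by (simp add: power2_eq_square algebra_simps)
    finally show ?thesis .
  qed
  have "{\<omega> \<in> space M. \<not> inj_on (sector n c) (Phi \<omega> \<inter> cball c d)}
      = (\<Union>j<n. {\<omega> \<in> space M. \<not> pcount (Phi \<omega>) (D j) \<le> 1})"
  proof -
    have "inj_on (sector n c) (Phi \<omega> \<inter> cball c d) \<longleftrightarrow> (\<forall>j<n. pcount (Phi \<omega>) (D j) \<le> 1)"
      if "\<omega> \<in> space M" for \<omega>
      unfolding D_def by (rule sector_inj_iff[OF n poisson_ppD(1)[OF pp _ _ that]]) auto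
    then show ?thesis by auto
  qed
  also have "prob \<dots> \<le> (\<Sum>j<n. prob {\<omega> \<in> space M. \<not> pcount (Phi \<omega>) (D j) \<le> 1})"
    by (rule finite_measure_subadditive_finite) auto
  also have "\<dots> \<le> (\<Sum>j<n. a\<^sup>2)"
    by (rule sum_mono) (use one in auto)
  also have "\<dots> = (lam * pi * d\<^sup>2)\<^sup>2 / real n"
    using n by (simp add: a_def power2_eq_square)
  finally show ?thesis .
qed

section \<open>Passage to the limit of infinitely many sectors\<close>

lemma binomial_over_power_tendsto:
  "(\<lambda>n. real (n choose k) / real n ^ k) \<longlonglongrightarrow> 1 / fact k"
proof -
  have "(\<lambda>n. (\<Prod>i<k. 1 - real i / real n) / fact k) \<longlonglongrightarrow> (\<Prod>i<k. 1 - 0) / fact k"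
    by (intro tendsto_intros lim_const_over_n) auto
  moreover have "\<forall>\<^sub>F n in sequentially. (\<Prod>i<k. 1 - real i / real n) / fact k
      = real (n choose k) / real n ^ k"
    using eventually_gt_at_top[of 0]
  proof eventually_elim
    case (elim n)
    have "(\<Prod>i<k. 1 - real i / real n) = (\<Prod>i<k. (real n - real i) / real n)"
      using elim by (intro prod.cong) (auto simp: field_simps)
    also have "\<dots> = (\<Prod>i<k. real n - real i) / real n ^ k"
      by (simp add: prod_dividef)
    finally show ?case
      by (simp add: binomial_gbinomial gbinomial_prod_rev lessThan_atLeast0)
  qed
  ultimately show ?thesis
    by (auto elim: Lim_transform_eventually)
qed

lemma (in prob_space) prob_ranges_in_both:
  assumes pp: "poisson_pp M Phi lam" and pp': "poisson_pp M Psi lam" and ind: "indep_pp M Phi Psi"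
    and lam: "lam > 0" and d: "d > 0"
    and A: "\<And>i. i < k \<Longrightarrow> A i \<in> sets borel" and B: "\<And>i. i < k \<Longrightarrow> B i \<in> sets borel"
  shows "prob {\<omega> \<in> space M. ranges_in d c k A (Phi \<omega>) \<and> ranges_in d c' k B (Psi \<omega>)}
    = (exp (- (lam * pi * d\<^sup>2)) * (lam * pi * d\<^sup>2) ^ k / fact k)\<^sup>2 *
      (\<Prod>i<k. measure (radial d) (A i) * measure (radial d) (B i))" (is "prob ?F = ?L")
proof -
  define m where "m = lam * pi * d\<^sup>2"
  define T where "T n \<omega> \<longleftrightarrow> inj_on (sector n c) (Phi \<omega> \<inter> cball c d)
    \<and> inj_on (sector n c') (Psi \<omega> \<inter> cball c' d)" for n \<omega>
  \<comment> \<open>\<open>G n\<close> is the part of the event without shared sectors. It is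
    computed exactly below, as a disjoint union over pairs of \<open>k\<close>-subsets of
    sectors.\<close>
  define G where "G n = {\<omega> \<in> ?F. T n \<omega>}" for n
  define \<Q> where "\<Q> n = {Q. Q \<subseteq> {..<n} \<and> card Q = k}" for n :: nat
  define E where "E n QQ = {\<omega> \<in> space M. occupied d c (sector n c) A (fst QQ) (Phi \<omega>) \<and>
      occupied d c' (sector n c') B (snd QQ) (Psi \<omega>)}" for n QQ
  note [measurable] = measurable_ranges_in[OF pp d, of k A c] measurable_ranges_in[OF pp' d, of k B c']
  have [measurable]: "?F \<in> events" using A B by measurable
  have fin: "finite (Phi \<omega> \<inter> cball c d)" "finite (Psi \<omega> \<inter> cball c' d)" if "\<omega> \<in> space M" for \<omega>
    using poisson_ppD(1)[OF pp _ _ that] poisson_ppD(1)[OF pp' _ _ that] by auto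
  have [measurable]: "Measurable.pred M (T n)" if "n > 0" for n
    using measurable_sector_inj[OF pp that, of c d] measurable_sector_inj[OF pp' that, of c' d]
    unfolding T_def by simp
  have G_eq: "G n = (\<Union>QQ\<in>\<Q> n \<times> \<Q> n. E n QQ)" if n: "n > 0" for n
  proof -
    have 1: "ranges_in d c k A P \<and> inj_on (sector n c) (P \<inter> cball c d) \<longleftrightarrow>
        (\<exists>Q\<in>\<Q> n. occupied d c (sector n c) A Q P)" if "finite (P \<inter> cball c d)" for c A P
    proof
      assume "ranges_in d c k A P \<and> inj_on (sector n c) (P \<inter> cball c d)"
      then show "\<exists>Q\<in>\<Q> n. occupied d c (sector n c) A Q P"
        using ex_occupied_iff_ranges_in[OF that order_compatible_sector, of n n k A] sector_less[OF n, of c]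
        by (auto simp: \<Q>_def)
    next
      assume o: "\<exists>Q\<in>\<Q> n. occupied d c (sector n c) A Q P"
      then obtain Q where "Q \<subseteq> {..<n}" "occupied d c (sector n c) A Q P" by (auto simp: \<Q>_def)
      then have i: "inj_on (sector n c) (P \<inter> cball c d)"
        using occupied_imp(1)[OF that] finite_subset[OF _ finite_lessThan] by blast
      then show "ranges_in d c k A P \<and> inj_on (sector n c) (P \<inter> cball c d)"
        using ex_occupied_iff_ranges_in[OF that order_compatible_sector[OF i], of n k A] o
          sector_less[OF n, of c] by (auto simp: \<Q>_def)
    qed
    have "\<omega> \<in> G n \<longleftrightarrow> \<omega> \<in> (\<Union>QQ\<in>\<Q> n \<times> \<Q> n. E n QQ)" for \<omega>
    proof (cases "\<omega> \<in> space M")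
      case True
      have "\<omega> \<in> G n \<longleftrightarrow> (\<exists>Q\<in>\<Q> n. occupied d c (sector n c) A Q (Phi \<omega>)) \<and>
          (\<exists>Q\<in>\<Q> n. occupied d c' (sector n c') B Q (Psi \<omega>))"
        using True unfolding G_def T_def 1[OF fin(1)[OF True], symmetric] 1[OF fin(2)[OF True], symmetric]
        by auto
      then show ?thesis using True by (auto simp: E_def)
    qed (auto simp: G_def E_def)
    then show ?thesis by blast
  qed
  have E_events: "E n QQ \<in> events" if "QQ \<in> \<Q> n \<times> \<Q> n" for n QQ
  proof -
    have "Measurable.pred M (\<lambda>\<omega>. occupied d c (sector n c) A (fst QQ) (Phi \<omega>))"
      "Measurable.pred M (\<lambda>\<omega>. occupied d c' (sector n c') B (snd QQ) (Psi \<omega>))"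
      using that A B by (auto intro!: measurable_occupied[OF pp] measurable_occupied[OF pp'] simp: \<Q>_def)
    then show ?thesis unfolding E_def by measurable
  qed
  have E_prob: "prob (E n QQ) = (exp (- m))\<^sup>2 *
      (\<Prod>i<k. (m / real n)\<^sup>2 * (measure (radial d) (A i) * measure (radial d) (B i)))"
    if n: "n > 0" and QQ: "QQ \<in> \<Q> n \<times> \<Q> n" for n QQ
  proof -
    have "prob (E n QQ) = prob {\<omega> \<in> space M. occupied d c (sector n c) A (fst QQ) (Phi \<omega>)} *
      prob {\<omega> \<in> space M. occupied d c' (sector n c') B (snd QQ) (Psi \<omega>)}"
      unfolding E_def using QQ A B by (intro prob_occupied_both[OF ind]) (auto simp: \<Q>_def)
    also have "prob {\<omega> \<in> space M. occupied d c (sector n c) A (fst QQ) (Phi \<omega>)}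
        = exp (- m) * (\<Prod>i<k. m / real n * measure (radial d) (A i))"
      using prob_occupied[OF pp d n, of "fst QQ" A c] QQ A by (auto simp: \<Q>_def m_def)
    also have "prob {\<omega> \<in> space M. occupied d c' (sector n c') B (snd QQ) (Psi \<omega>)}
        = exp (- m) * (\<Prod>i<k. m / real n * measure (radial d) (B i))"
      using prob_occupied[OF pp' d n, of "snd QQ" B c'] QQ B by (auto simp: \<Q>_def m_def)
    also have "exp (- m) * (\<Prod>i<k. m / real n * measure (radial d) (A i)) *
        (exp (- m) * (\<Prod>i<k. m / real n * measure (radial d) (B i)))
      = (exp (- m))\<^sup>2 * ((\<Prod>i<k. m / real n * measure (radial d) (A i)) *
        (\<Prod>i<k. m / real n * measure (radial d) (B i)))"
      by (simp only: power2_eq_square mult_ac)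
    finally show ?thesis
      by (simp only: prod.distrib[symmetric] power2_eq_square mult_ac)
  qed
  have G_prob: "prob (G n) = (real (n choose k) / real n ^ k)\<^sup>2 * ((exp (- m) * m ^ k)\<^sup>2 *
      (\<Prod>i<k. measure (radial d) (A i) * measure (radial d) (B i)))" if n: "n > 0" for n
  proof -
    have finQ: "finite (\<Q> n)" by (simp add: \<Q>_def)
    have cardQ: "card (\<Q> n) = n choose k" by (simp add: \<Q>_def n_subsets)
    \<comment> \<open>An outcome in \<open>E n QQ\<close> determines \<open>QQ\<close>: its
      components are the sets of sectors occupied by the two processes.\<close>
    have disj: "disjoint_family_on (E n) (\<Q> n \<times> \<Q> n)"
      unfolding disjoint_family_on_def
    proof (intro ballI impI)
      fix q r assume q: "q \<in> \<Q> n \<times> \<Q> n" and r: "r \<in> \<Q> n \<times> \<Q> n" and ne: "q \<noteq> r"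
      have fq: "finite (fst q)" "finite (snd q)" "finite (fst r)" "finite (snd r)"
        using q r finite_subset[OF _ finite_lessThan[of n]] by (auto simp: \<Q>_def)
      show "E n q \<inter> E n r = {}"
      proof (rule ccontr)
        assume "E n q \<inter> E n r \<noteq> {}"
        then obtain \<omega> where "\<omega> \<in> E n q" "\<omega> \<in> E n r" by blast
        then have "fst q = fst r" "snd q = snd r"
          using occupied_imp(2)[OF fin(1)] occupied_imp(2)[OF fin(2)] fq unfolding E_def mem_Collect_eq by metis+
        then show False using ne by (simp add: prod_eq_iff)
      qed
    qed
    have "prob (G n) = (\<Sum>QQ\<in>\<Q> n \<times> \<Q> n. prob (E n QQ))"
      unfolding G_eq[OF n]
      by (rule finite_measure_finite_Union) (use finQ disj E_events in auto)
    also have "\<dots> = real (card (\<Q> n \<times> \<Q> n)) * ((exp (- m))\<^sup>2 *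
        (\<Prod>i<k. (m / real n)\<^sup>2 * (measure (radial d) (A i) * measure (radial d) (B i))))"
      using E_prob[OF n] by simp
    also have "(\<Prod>i<k. (m / real n)\<^sup>2 * (measure (radial d) (A i) * measure (radial d) (B i)))
      = ((m / real n) ^ k)\<^sup>2 * (\<Prod>i<k. measure (radial d) (A i) * measure (radial d) (B i))"
      by (simp only: prod.distrib[of "\<lambda>_. (m / real n)\<^sup>2"] prod_constant card_lessThan power_mult[symmetric] mult.commute[of k])
    also have "real (card (\<Q> n \<times> \<Q> n)) * ((exp (- m))\<^sup>2 * (((m / real n) ^ k)\<^sup>2 *
        (\<Prod>i<k. measure (radial d) (A i) * measure (radial d) (B i))))
      = (real (n choose k) / real n ^ k)\<^sup>2 * ((exp (- m) * m ^ k)\<^sup>2 *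
      (\<Prod>i<k. measure (radial d) (A i) * measure (radial d) (B i)))"
      unfolding card_cartesian_product cardQ of_nat_mult power_divide power_mult_distrib
      by (simp only: power2_eq_square times_divide_eq_left times_divide_eq_right mult_ac)
    finally show ?thesis .
  qed
  have "(\<lambda>n. (real (n choose k) / real n ^ k)\<^sup>2 * ((exp (- m) * m ^ k)\<^sup>2 *
      (\<Prod>i<k. measure (radial d) (A i) * measure (radial d) (B i)))) \<longlonglongrightarrow>
    (1 / fact k)\<^sup>2 * ((exp (- m) * m ^ k)\<^sup>2 *
      (\<Prod>i<k. measure (radial d) (A i) * measure (radial d) (B i)))"
    by (intro tendsto_intros binomial_over_power_tendsto)
  also have "(1 / fact k)\<^sup>2 * ((exp (- m) * m ^ k)\<^sup>2 *
      (\<Prod>i<k. measure (radial d) (A i) * measure (radial d) (B i))) = ?L"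
    by (simp add: m_def power_divide)
  finally have lim: "(\<lambda>n. prob (G n)) \<longlonglongrightarrow> ?L"
    by (rule Lim_transform_eventually)
      (rule eventually_mono[OF eventually_gt_at_top[of 0]], rule G_prob[symmetric])
  \<comment> \<open>What \<open>G n\<close> misses lies in one of the two collision events, each of
    probability at most \<open>m\<^sup>2 / n\<close>. Letting \<open>n\<close> grow squeezes the
    probability of the event, which does not depend on \<open>n\<close>, to the limit.\<close>
  have bound: "prob (G n) \<le> prob ?F \<and> prob ?F \<le> prob (G n) + 2 * (m\<^sup>2 / real n)" if n: "n > 0" for n
  proof -
    let ?N = "{\<omega> \<in> space M. \<not> inj_on (sector n c) (Phi \<omega> \<inter> cball c d)}"
    let ?N' = "{\<omega> \<in> space M. \<not> inj_on (sector n c') (Psi \<omega> \<inter> cball c' d)}"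
    note [measurable] = measurable_sector_inj[OF pp n, of c d] measurable_sector_inj[OF pp' n, of c' d]
    have [measurable]: "?N \<in> events" "?N' \<in> events" by measurable
    have [measurable]: "G n \<in> events"
      unfolding G_eq[OF n] using E_events by (intro sets.finite_UN) (auto simp: \<Q>_def)
    have "?F \<subseteq> G n \<union> (?N \<union> ?N')" by (auto simp: G_def T_def)
    then have "prob ?F \<le> prob (G n \<union> (?N \<union> ?N'))"
      by (rule finite_measure_mono) measurable
    also have "\<dots> \<le> prob (G n) + (prob ?N + prob ?N')"
      using measure_Un_le[of "G n" M "?N \<union> ?N'"] measure_Un_le[of ?N M ?N'] by simp
    also have "\<dots> \<le> prob (G n) + (m\<^sup>2 / real n + m\<^sup>2 / real n)"
      unfolding m_def using prob_not_sector_inj[OF pp lam d n, of c] prob_not_sector_inj[OF pp' lam d n, of c']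
      by (intro add_left_mono add_mono)
    finally have "prob ?F \<le> prob (G n) + 2 * (m\<^sup>2 / real n)" by simp
    moreover have "prob (G n) \<le> prob ?F"
      by (rule finite_measure_mono[OF _ \<open>?F \<in> events\<close>]) (auto simp: G_def)
    ultimately show ?thesis by blast
  qed
  have lim': "(\<lambda>n. prob (G n) + 2 * (m\<^sup>2 / real n)) \<longlonglongrightarrow> ?L + 2 * 0"
    by (intro tendsto_intros lim lim_const_over_n)
  have "prob ?F \<le> ?L + 2 * 0"
    by (rule tendsto_lowerbound[OF lim' eventually_mono[OF eventually_gt_at_top[of 0]]])
      (use bound in auto)
  moreover have "?L \<le> prob ?F"
    by (rule tendsto_upperbound[OF lim eventually_mono[OF eventually_gt_at_top[of 0]]])
      (use bound in auto)
  ultimately show ?thesis by simp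
qed

section \<open>The radial law\<close>

lemma measure_radial_lessThan:
  assumes d: "d > 0" and t: "t \<le> d"
  shows "measure (radial d) {..<t} = (if t \<le> 0 then 0 else t\<^sup>2 / d\<^sup>2)"
proof (cases "t \<le> 0")
  case True
  then have E: "{z::complex. norm z \<le> d \<and> norm z \<in> {..<t}} = {}"
    by (auto simp: not_less intro: order_trans[OF _ norm_ge_zero])
  show ?thesis using True measure_radial[OF d, of "{..<t}"] unfolding E by simp
next
  case False
  have "{z::complex. norm z \<le> d \<and> norm z \<in> {..<t}} = ball 0 t"
    using t by auto
  then show ?thesis using False d by (simp add: measure_radial content_ball unit_ball_vol_2)
qed

lemma measure_radial_atMost:
  assumes d: "d > 0"
  shows "measure (radial d) {..t} = (if t < 0 then 0 else (min t d)\<^sup>2 / d\<^sup>2)"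
proof (cases "t < 0")
  case True
  then have E: "{z::complex. norm z \<le> d \<and> norm z \<in> {..t}} = {}"
    by (auto simp: not_le intro: less_le_trans[OF _ norm_ge_zero])
  show ?thesis using True measure_radial[OF d, of "{..t}"] unfolding E by simp
next
  case False
  have "{z::complex. norm z \<le> d \<and> norm z \<in> {..t}} = cball 0 (min t d)"
    by auto
  then show ?thesis using False d by (simp add: measure_radial measure_disk)
qed

text \<open>Both sides have the distribution function \<open>t\<^sup>2 / d\<^sup>2\<close> on the
  interval from 0 to \<open>d\<close>: on the left as a ratio of disk areas, on the right by
  integrating the density.\<close>

lemma radial_eq_density:
  assumes d: "d > 0"
  shows "radial d = density lborel (\<lambda>r. ennreal (2 * r / d\<^sup>2) * indicator {0..d} r)" (is "_ = ?D")
proof (rule cdf_unique)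
  have em: "emeasure ?D {..t} = ennreal (if t < 0 then 0 else (min t d)\<^sup>2 / d\<^sup>2)" for t
  proof -
    have "emeasure ?D {..t} = (\<integral>\<^sup>+r. ennreal (2 * r / d\<^sup>2) * indicator {0..min t d} r \<partial>lborel)"
      by (subst emeasure_density) (auto intro!: nn_integral_cong simp: indicator_def)
    also have "\<dots> = ennreal (if t < 0 then 0 else (min t d)\<^sup>2 / d\<^sup>2)"
    proof (cases "t < 0")
      case False
      then have "(\<integral>\<^sup>+r. ennreal (2 * r / d\<^sup>2) * indicator {0..min t d} r \<partial>lborel)
          = ennreal ((min t d)\<^sup>2 / d\<^sup>2 - 0\<^sup>2 / d\<^sup>2)"
        using d by (intro nn_integral_FTC_Icc)
            (auto intro!: derivative_eq_intros simp: field_simps eval_nat_numeral)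
      then show ?thesis using False by simp
    qed auto
    finally show ?thesis .
  qed
  have "emeasure ?D (space ?D) = emeasure ?D {..d}"
    by (auto simp: emeasure_density indicator_def intro!: nn_integral_cong)
  then have ps: "prob_space ?D"
    using d by (intro prob_spaceI) (simp add: em)
  then show "real_distribution ?D"
    by (auto simp: real_distribution_def real_distribution_axioms_def)
  show "real_distribution (radial d)"
    using prob_space_radial[OF d] by (auto simp: real_distribution_def real_distribution_axioms_def)
  show "cdf (radial d) = cdf ?D"
  proof
    fix t
    have "measure ?D {..t} = (if t < 0 then 0 else (min t d)\<^sup>2 / d\<^sup>2)"
      unfolding measure_def em by simp
    then show "cdf (radial d) t = cdf ?D t"
      by (simp add: cdf_def measure_radial_atMost[OF d])
  qed
qed

text \<open>The probability that two independent radii differ by at most \<open>e\<close>, written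
  \<open>q\<close> in the final computation.\<close>

definition close_prob :: "real \<Rightarrow> real \<Rightarrow> real" where
  "close_prob d e = measure (radial d \<Otimes>\<^sub>M radial d) {(r, s). \<bar>r - s\<bar> \<le> e}"

text \<open>The probability that one radius exceeds an independent one by more than
  \<open>e\<close>. For \<open>r\<close> between \<open>e\<close> and \<open>d\<close> the inner
  probability is \<open>(r - e)\<^sup>2 / d\<^sup>2\<close>, to be integrated against the radial
  density.\<close>

lemma nn_integral_radial_lessThan:
  assumes d: "d > 0" and e: "e \<ge> 0"
  shows "(\<integral>\<^sup>+r. emeasure (radial d) {..<r - e} \<partial>radial d)
    = ennreal (if e < d then ((d - e) ^ 4 / 2 + 2 * e * (d - e) ^ 3 / 3) / d ^ 4 else 0)"
proof -
  interpret R: prob_space "radial d" by (rule prob_space_radial[OF d])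
  have "(\<integral>\<^sup>+r. emeasure (radial d) {..<r - e} \<partial>radial d)
      = (\<integral>\<^sup>+r. ennreal (2 * r / d\<^sup>2) * indicator {0..d} r * emeasure (radial d) {..<r - e} \<partial>lborel)"
  proof -
    have [measurable]: "(\<lambda>r. emeasure (radial d) {..<r - e}) \<in> borel_measurable borel"
    proof -
      have "{z \<in> space (borel \<Otimes>\<^sub>M radial d). snd z < fst z - e} \<in> sets (borel \<Otimes>\<^sub>M radial d)"
        by measurable
      then have "{z. snd z < fst z - e} \<in> sets (borel \<Otimes>\<^sub>M radial d)"
        by (simp add: space_pair_measure)
      from R.measurable_emeasure_Pair[OF this] show ?thesis by (simp add: vimage_def lessThan_def)
    qed
    have "(\<integral>\<^sup>+r. g r \<partial>radial d)
        = (\<integral>\<^sup>+r. g r \<partial>density lborel (\<lambda>r. ennreal (2 * r / d\<^sup>2) * indicator {0..d} r))" for g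
      by (simp only: radial_eq_density[OF d])
    then show ?thesis
      by (simp only:) (subst nn_integral_density, auto)
  qed
  also have "\<dots> = (\<integral>\<^sup>+r. ennreal (2 * r * (r - e)\<^sup>2 / d ^ 4) * indicator {e..d} r \<partial>lborel)"
  proof (intro nn_integral_cong)
    fix r
    show "ennreal (2 * r / d\<^sup>2) * indicator {0..d} r * emeasure (radial d) {..<r - e}
      = ennreal (2 * r * (r - e)\<^sup>2 / d ^ 4) * indicator {e..d} r"
    proof (cases "r \<in> {0..d}")
      case True
      then have "emeasure (radial d) {..<r - e} = ennreal (if r \<le> e then 0 else (r - e)\<^sup>2 / d\<^sup>2)"
        using e d by (subst R.emeasure_eq_measure, subst measure_radial_lessThan) auto
      moreover have "ennreal (2 * r / d\<^sup>2) * ennreal ((r - e)\<^sup>2 / d\<^sup>2)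
          = ennreal (2 * r * (r - e)\<^sup>2 / d ^ 4)"
        using True by (subst ennreal_mult[symmetric]) (auto simp: power2_eq_square power4_eq_xxxx)
      ultimately show ?thesis
        \<comment> \<open>At \<open>r = e\<close> the closed interval on the right includes the
          point while the inner probability is already 0; both sides vanish there.\<close>
        using True e by (cases "r = e") (auto simp: indicator_def)
    qed (use e in \<open>auto simp: indicator_def\<close>)
  qed
  also have "\<dots> = ennreal (if e < d then ((d - e) ^ 4 / 2 + 2 * e * (d - e) ^ 3 / 3) / d ^ 4 else 0)"
  proof (cases "e < d")
    case True
    \<comment> \<open>The antiderivative comes from splitting \<open>2 * r * (r - e)\<^sup>2\<close>
      into \<open>2 * (r - e) ^ 3 + 2 * e * (r - e)\<^sup>2\<close>.\<close>
    have "(\<integral>\<^sup>+r. ennreal (2 * r * (r - e)\<^sup>2 / d ^ 4) * indicator {e..d} r \<partial>lborel)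
        = ennreal (((d - e) ^ 4 / 2 + 2 * e * (d - e) ^ 3 / 3) / d ^ 4
            - ((e - e) ^ 4 / 2 + 2 * e * (e - e) ^ 3 / 3) / d ^ 4)"
    proof (rule nn_integral_FTC_Icc)
      fix r assume r: "r \<in> {e..d}"
      show "((\<lambda>r. ((r - e) ^ 4 / 2 + 2 * e * (r - e) ^ 3 / 3) / d ^ 4)
          has_real_derivative 2 * r * (r - e)\<^sup>2 / d ^ 4) (at r)"
        using d by (auto intro!: derivative_eq_intros simp: field_simps eval_nat_numeral)
      show "0 \<le> 2 * r * (r - e)\<^sup>2 / d ^ 4" using r e by auto
    qed (use True in auto)
    then show ?thesis using True by simp
  next
    case False
    then have "ennreal (2 * r * (r - e)\<^sup>2 / d ^ 4) * indicator {e..d} r = 0" for r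
      by (cases "r = e") (auto simp: indicator_def)
    then show ?thesis using False by (simp only: nn_integral_const) simp
  qed
  finally show ?thesis .
qed

text \<open>The complement consists of two disjoint mirror images, one radius exceeding the other by
  more than \<open>e\<close>. Each has the probability \<open>I\<close> of
  \<open>nn_integral_radial_lessThan\<close>, and \<open>1 - 2 * I\<close> simplifies to the stated
  quotient.\<close>

lemma close_prob_eq:
  assumes d: "d > 0" and e: "e \<ge> 0"
  shows "close_prob d e =
    (if e < d then (8 * d ^ 3 * e - 6 * d ^ 2 * e ^ 2 + e ^ 4) / (3 * d ^ 4) else 1)"
proof -
  interpret R: prob_space "radial d" by (rule prob_space_radial[OF d])
  interpret RR: pair_prob_space "radial d" "radial d" ..
  let ?P = "radial d \<Otimes>\<^sub>M radial d"
  define I where "I = (if e < d then ((d - e) ^ 4 / 2 + 2 * e * (d - e) ^ 3 / 3) / d ^ 4 else 0)"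
  let ?L = "{z. snd z < fst z - e}" and ?U = "{z. fst z < snd z - e}"
  let ?X = "{(r, s). \<bar>r - s\<bar> \<le> e} :: (real \<times> real) set"
  have sp: "space ?P = UNIV" by (simp add: space_pair_measure)
  have "{z \<in> space ?P. snd z < fst z - e} \<in> sets ?P" "{z \<in> space ?P. fst z < snd z - e} \<in> sets ?P"
    by measurable
  then have L: "?L \<in> sets ?P" "?U \<in> sets ?P" by (simp_all add: sp)
  have I: "I \<ge> 0" using d e by (simp add: I_def)
  have "emeasure ?P ?L = (\<integral>\<^sup>+r. emeasure (radial d) (Pair r -` ?L) \<partial>radial d)"
    by (rule R.emeasure_pair_measure_alt[OF L(1)])
  also have "(\<lambda>r. Pair r -` ?L) = (\<lambda>r. {..<r - e})" by auto
  finally have mL: "measure ?P ?L = I"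
    using I by (simp add: nn_integral_radial_lessThan[OF d e] I_def measure_def)
  have "emeasure ?P ?U = (\<integral>\<^sup>+s. emeasure (radial d) ((\<lambda>r. (r, s)) -` ?U) \<partial>radial d)"
    by (rule RR.emeasure_pair_measure_alt2[OF L(2)])
  also have "(\<lambda>s. (\<lambda>r. (r, s)) -` ?U) = (\<lambda>s. {..<s - e})" by auto
  finally have mU: "measure ?P ?U = I"
    using I by (simp add: nn_integral_radial_lessThan[OF d e] I_def measure_def)
  have "?X = space ?P - (?L \<union> ?U)" by (auto simp: sp)
  then have "close_prob d e = 1 - measure ?P (?L \<union> ?U)"
    unfolding close_prob_def using L RR.prob_compl[of "?L \<union> ?U"] by simp
  also have "measure ?P (?L \<union> ?U) = I + I"
    using L e by (subst RR.finite_measure_Union) (auto simp: mL mU)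
  also have "1 - (I + I) = (if e < d then (8 * d ^ 3 * e - 6 * d ^ 2 * e ^ 2 + e ^ 4) / (3 * d ^ 4) else 1)"
    using d by (simp add: I_def field_simps eval_nat_numeral)
  finally show ?thesis .
qed

section \<open>From rectangles to general events of a pair of radii\<close>

text \<open>Rectangles determine a product measure, so a product formula on rectangles extends to
  every measurable set of pairs. The event \<open>E\<close> will carry the conditions on all other
  coordinates, and \<open>C\<close> its contribution to the probability.\<close>

lemma (in prob_space) prob_pair_extend:
  fixes U V :: "'a \<Rightarrow> real" and R :: "real measure"
  assumes R: "prob_space R" "sets R = sets borel" and E[measurable]: "E \<in> events"
    and U[measurable]: "U \<in> borel_measurable M" and V[measurable]: "V \<in> borel_measurable M"
    and C: "C \<ge> 0"
    and eq: "\<And>A B. A \<in> sets borel \<Longrightarrow> B \<in> sets borel \<Longrightarrow>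
      prob {\<omega> \<in> E. U \<omega> \<in> A \<and> V \<omega> \<in> B} = C * (measure R A * measure R B)"
    and X: "X \<in> sets (borel \<Otimes>\<^sub>M borel)"
  shows "prob {\<omega> \<in> E. (U \<omega>, V \<omega>) \<in> X} = C * measure (R \<Otimes>\<^sub>M R) X"
proof -
  interpret R: prob_space R by fact
  interpret RR: pair_prob_space R R ..
  have [measurable_cong]: "sets R = sets borel" by fact
  define N where "N = distr (density M (indicator E)) (borel \<Otimes>\<^sub>M borel) (\<lambda>\<omega>. (U \<omega>, V \<omega>))"
  have N: "emeasure N S = ennreal (prob {\<omega> \<in> E. (U \<omega>, V \<omega>) \<in> S})" if [measurable]: "S \<in> sets (borel \<Otimes>\<^sub>M borel)" for S
  proof -
    have "emeasure N S = emeasure (density M (indicator E)) ((\<lambda>\<omega>. (U \<omega>, V \<omega>)) -` S \<inter> space M)"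
      unfolding N_def by (subst emeasure_distr) auto
    also have "\<dots> = emeasure M (E \<inter> ((\<lambda>\<omega>. (U \<omega>, V \<omega>)) -` S \<inter> space M))"
      by (rule emeasure_restricted) measurable
    also have "E \<inter> ((\<lambda>\<omega>. (U \<omega>, V \<omega>)) -` S \<inter> space M) = {\<omega> \<in> E. (U \<omega>, V \<omega>) \<in> S}"
      using sets.sets_into_space[OF E] by auto
    finally show ?thesis by (simp add: emeasure_eq_measure)
  qed
  have setsRR: "sets (R \<Otimes>\<^sub>M R) = sets (borel \<Otimes>\<^sub>M borel)"
    by (rule sets_pair_measure_cong) fact+
  \<comment> \<open>The constant is absorbed into the first factor, so that \<open>N\<close> is
    compared with a genuine product of two measures and uniqueness of product measures
    applies.\<close>
  have "scale_measure (ennreal C) R \<Otimes>\<^sub>M R = N"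
  proof (rule pair_measure_eqI)
    have "finite_measure (scale_measure (ennreal C) R)"
      by (rule finite_measureI) (simp add: space_scale_measure R.emeasure_space_1)
    then show "sigma_finite_measure (scale_measure (ennreal C) R)"
      by (rule finite_measure.axioms(1))
    show "sigma_finite_measure R" ..
    show "sets (scale_measure (ennreal C) R \<Otimes>\<^sub>M R) = sets N"
      unfolding N_def using R(2) by (simp cong: sets_pair_measure_cong)
    fix A B assume "A \<in> sets (scale_measure (ennreal C) R)" "B \<in> sets R"
    then have AB: "A \<in> sets borel" "B \<in> sets borel" by (auto simp: R(2))
    then have "emeasure N (A \<times> B) = ennreal (C * (measure R A * measure R B))"
      by (simp add: N eq)
    also have "\<dots> = emeasure (scale_measure (ennreal C) R) A * emeasure R B"
      using C by (simp add: R.emeasure_eq_measure ennreal_mult[symmetric] mult.assoc)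
    finally show "emeasure (scale_measure (ennreal C) R) A * emeasure R B = emeasure N (A \<times> B)" ..
  qed
  then have "ennreal (prob {\<omega> \<in> E. (U \<omega>, V \<omega>) \<in> X}) = emeasure (scale_measure (ennreal C) R \<Otimes>\<^sub>M R) X"
    using N[OF X] by simp
  also have "\<dots> = (\<integral>\<^sup>+r. emeasure R (Pair r -` X) \<partial>scale_measure (ennreal C) R)"
    by (rule R.emeasure_pair_measure_alt) (use X setsRR in \<open>simp cong: sets_pair_measure_cong\<close>)
  also have "\<dots> = ennreal C * (\<integral>\<^sup>+r. emeasure R (Pair r -` X) \<partial>R)"
    by (rule nn_integral_scale_measure) (use X setsRR R.measurable_emeasure_Pair in blast)
  also have "(\<integral>\<^sup>+r. emeasure R (Pair r -` X) \<partial>R) = emeasure (R \<Otimes>\<^sub>M R) X"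
    by (rule R.emeasure_pair_measure_alt[symmetric]) (use X setsRR in simp)
  also have "ennreal C * \<dots> = ennreal (C * measure (R \<Otimes>\<^sub>M R) X)"
    using C by (simp add: RR.emeasure_eq_measure ennreal_mult)
  finally show ?thesis using C by (simp add: ennreal_inj)
qed

section \<open>Localizability probability\<close>

text \<open>The default 0 beyond the length makes every coordinate a total real random variable,
  whatever the number of landmarks.\<close>

definition nth_range :: "real \<Rightarrow> complex \<Rightarrow> nat \<Rightarrow> complex set \<Rightarrow> real" where
  "nth_range d c i P = (if i < length (range_vec d c P) then range_vec d c P ! i else 0)"

lemma ranges_in_iff:
  "ranges_in d c k A P \<longleftrightarrow> length (range_vec d c P) = k \<and> (\<forall>i<k. nth_range d c i P \<in> A i)"
  by (auto simp: ranges_in_def nth_range_def)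

lemma measurable_length_range_vec:
  assumes "poisson_pp M Phi lam" "d > 0"
  shows "(\<lambda>\<omega>. length (range_vec d c (Phi \<omega>))) \<in> measurable M (count_space UNIV)"
proof -
  have "(\<lambda>\<omega>. length (range_vec d c (Phi \<omega>))) -` {k} \<inter> space M \<in> sets M" for k
  proof -
    have "(\<lambda>\<omega>. length (range_vec d c (Phi \<omega>))) -` {k} \<inter> space M
        = {\<omega> \<in> space M. ranges_in d c k (\<lambda>_. UNIV) (Phi \<omega>)}"
      by (auto simp: ranges_in_def)
    then show ?thesis
      using measurable_ranges_in[OF assms, of k "\<lambda>_. UNIV" c] by simp
  qed
  then show ?thesis by (simp add: measurable_count_space_eq2_countable)
qed

lemma measurable_nth_range:
  assumes "poisson_pp M Phi lam" "d > 0"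
  shows "(\<lambda>\<omega>. nth_range d c i (Phi \<omega>)) \<in> borel_measurable M"
proof (rule measurableI)
  fix S :: "real set" assume S: "S \<in> sets borel"
  note [measurable] = measurable_length_range_vec[OF assms, of c]
  have [measurable]: "Measurable.pred M (\<lambda>\<omega>. ranges_in d c k (\<lambda>j. if j = i then S else UNIV) (Phi \<omega>))" for k
    by (rule measurable_ranges_in[OF assms]) (use S in auto)
  \<comment> \<open>Short vectors contribute through the default value, the others through the
    countably many rectangle events that constrain only entry \<open>i\<close>.\<close>
  have "(\<lambda>\<omega>. nth_range d c i (Phi \<omega>)) -` S \<inter> space M = {\<omega> \<in> space M.
      (length (range_vec d c (Phi \<omega>)) \<le> i \<and> 0 \<in> S) \<or>
      (\<exists>k. i < k \<and> ranges_in d c k (\<lambda>j. if j = i then S else UNIV) (Phi \<omega>))}"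
    by (auto simp: ranges_in_def nth_range_def split: if_splits)
  also have "\<dots> \<in> sets M" by measurable
  finally show "(\<lambda>\<omega>. nth_range d c i (Phi \<omega>)) -` S \<inter> space M \<in> sets M" .
qed auto

lemma (in prob_space) prob_ranges_close:
  assumes pp: "poisson_pp M Phi lam" and pp': "poisson_pp M Psi lam" and ind: "indep_pp M Phi Psi"
    and lam: "lam > 0" and d: "d > 0"
  shows "prob {\<omega> \<in> space M. length (range_vec d c (Phi \<omega>)) = k \<and> length (range_vec d c' (Psi \<omega>)) = k \<and>
      (\<forall>i<k. \<bar>nth_range d c i (Phi \<omega>) - nth_range d c' i (Psi \<omega>)\<bar> \<le> e)}
    = (exp (- (lam * pi * d\<^sup>2)) * (lam * pi * d\<^sup>2) ^ k / fact k)\<^sup>2 * close_prob d e ^ k"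
proof -
  define K where "K = (exp (- (lam * pi * d\<^sup>2)) * (lam * pi * d\<^sup>2) ^ k / fact k)\<^sup>2"
  define U where "U i \<omega> = nth_range d c i (Phi \<omega>)" for i \<omega>
  define V where "V i \<omega> = nth_range d c' i (Psi \<omega>)" for i \<omega>
  define len where "len \<omega> \<longleftrightarrow> length (range_vec d c (Phi \<omega>)) = k \<and> length (range_vec d c' (Psi \<omega>)) = k" for \<omega>
  have [measurable]: "U i \<in> borel_measurable M" "V i \<in> borel_measurable M" for i
    unfolding U_def V_def using measurable_nth_range[OF pp d] measurable_nth_range[OF pp' d] by auto
  note [measurable] = measurable_length_range_vec[OF pp d, of c] measurable_length_range_vec[OF pp' d, of c']
  have [measurable]: "Measurable.pred M len" unfolding len_def by measurable
  \<comment> \<open>Rectangles are replaced by the closeness relation one coordinate at a time.\<close>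
  have "prob {\<omega> \<in> space M. len \<omega> \<and> (\<forall>i<j. \<bar>U i \<omega> - V i \<omega>\<bar> \<le> e) \<and>
      (\<forall>i\<in>{j..<k}. U i \<omega> \<in> A i \<and> V i \<omega> \<in> B i)}
    = K * close_prob d e ^ j * (\<Prod>i\<in>{j..<k}. measure (radial d) (A i) * measure (radial d) (B i))"
    if "j \<le> k" "\<And>i. i < k \<Longrightarrow> A i \<in> sets borel" "\<And>i. i < k \<Longrightarrow> B i \<in> sets borel" for j A B
    using that
  proof (induction j arbitrary: A B)
    case 0
    have "{\<omega> \<in> space M. len \<omega> \<and> (\<forall>i<0. \<bar>U i \<omega> - V i \<omega>\<bar> \<le> e) \<and>
        (\<forall>i\<in>{0..<k}. U i \<omega> \<in> A i \<and> V i \<omega> \<in> B i)}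
      = {\<omega> \<in> space M. ranges_in d c k A (Phi \<omega>) \<and> ranges_in d c' k B (Psi \<omega>)}"
      by (auto simp: ranges_in_iff len_def U_def V_def)
    then show ?case
      using prob_ranges_in_both[OF pp pp' ind lam d, of k A B c c'] 0
      by (simp add: K_def lessThan_atLeast0)
  next
    case (Suc j)
    then have j: "j < k" by simp
    note AB = Suc.prems(2,3)
    \<comment> \<open>\<open>E\<close> leaves coordinate \<open>j\<close> free. Changing
      \<open>A\<close> and \<open>B\<close> at \<open>j\<close> in the induction hypothesis gives
      the product formula for that coordinate on \<open>E\<close>, which
      \<open>prob_pair_extend\<close> carries over to closeness.\<close>
    define E where "E = {\<omega> \<in> space M. len \<omega> \<and> (\<forall>i<j. \<bar>U i \<omega> - V i \<omega>\<bar> \<le> e) \<and>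
      (\<forall>i\<in>{Suc j..<k}. U i \<omega> \<in> A i \<and> V i \<omega> \<in> B i)}"
    define C where "C = K * close_prob d e ^ j *
      (\<Prod>i\<in>{Suc j..<k}. measure (radial d) (A i) * measure (radial d) (B i))"
    have [measurable]: "Measurable.pred M (\<lambda>\<omega>. \<forall>i\<in>{Suc j..<k}. U i \<omega> \<in> A i \<and> V i \<omega> \<in> B i)"
    proof (intro pred_intros_finite)
      fix i assume "i \<in> {Suc j..<k}"
      then have [measurable]: "A i \<in> sets borel" "B i \<in> sets borel" using AB by auto
      show "Measurable.pred M (\<lambda>\<omega>. U i \<omega> \<in> A i \<and> V i \<omega> \<in> B i)" by measurable
    qed auto
    have E: "E \<in> events" unfolding E_def by measurable
    have split: "{j..<k} = insert j {Suc j..<k}" using j by auto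
    have X: "{(r, s). \<bar>r - s\<bar> \<le> e} \<in> sets (borel \<Otimes>\<^sub>M (borel :: real measure))"
    proof -
      have "{z \<in> space (borel \<Otimes>\<^sub>M borel). \<bar>fst z - snd z :: real\<bar> \<le> e} \<in> sets (borel \<Otimes>\<^sub>M borel)"
        by measurable
      moreover have "{(r, s). \<bar>r - s\<bar> \<le> e} = {z \<in> space (borel \<Otimes>\<^sub>M borel). \<bar>fst z - snd z :: real\<bar> \<le> e}"
        by (auto simp: space_pair_measure)
      ultimately show ?thesis by (simp only:)
    qed
    have "prob {\<omega> \<in> E. (U j \<omega>, V j \<omega>) \<in> {(r, s). \<bar>r - s\<bar> \<le> e}}
        = C * measure (radial d \<Otimes>\<^sub>M radial d) {(r, s). \<bar>r - s\<bar> \<le> e}"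
    proof (rule prob_pair_extend[OF prob_space_radial[OF d] sets_radial E _ _ _ _ X])
      show "C \<ge> 0"
        unfolding C_def K_def close_prob_def by (intro mult_nonneg_nonneg prod_nonneg) auto
      fix A' B' :: "real set" assume A'B': "A' \<in> sets borel" "B' \<in> sets borel"
      have "{\<omega> \<in> E. U j \<omega> \<in> A' \<and> V j \<omega> \<in> B'}
        = {\<omega> \<in> space M. len \<omega> \<and> (\<forall>i<j. \<bar>U i \<omega> - V i \<omega>\<bar> \<le> e) \<and>
          (\<forall>i\<in>{j..<k}. U i \<omega> \<in> (A(j := A')) i \<and> V i \<omega> \<in> (B(j := B')) i)}"
        unfolding split E_def by auto
      also have "prob \<dots> = K * close_prob d e ^ j *
          (\<Prod>i\<in>{j..<k}. measure (radial d) ((A(j := A')) i) * measure (radial d) ((B(j := B')) i))"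
        by (rule Suc.IH) (use j AB A'B' in auto)
      also have "\<dots> = C * (measure (radial d) A' * measure (radial d) B')"
        unfolding split C_def by (simp add: mult_ac)
      finally show "prob {\<omega> \<in> E. U j \<omega> \<in> A' \<and> V j \<omega> \<in> B'}
          = C * (measure (radial d) A' * measure (radial d) B')" .
    qed auto
    also have "{\<omega> \<in> E. (U j \<omega>, V j \<omega>) \<in> {(r, s). \<bar>r - s\<bar> \<le> e}}
      = {\<omega> \<in> space M. len \<omega> \<and> (\<forall>i<Suc j. \<bar>U i \<omega> - V i \<omega>\<bar> \<le> e) \<and>
      (\<forall>i\<in>{Suc j..<k}. U i \<omega> \<in> A i \<and> V i \<omega> \<in> B i)}"
      by (auto simp: E_def less_Suc_eq)
    finally show ?case
      by (simp add: C_def close_prob_def)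
  qed
  from this[of k "\<lambda>_. UNIV" "\<lambda>_. UNIV"] show ?thesis
    by (simp add: K_def len_def U_def V_def)
qed

text \<open>The 0 inserted under the maximum covers empty vectors and is harmless for the comparison
  because \<open>e\<close> is nonnegative. Unequal lengths give an infinite distance.\<close>

lemma Delta_p_le_iff:
  assumes "e \<ge> 0"
  shows "Delta_p u v \<le> ereal e \<longleftrightarrow> length u = length v \<and> (\<forall>i<length u. \<bar>u ! i - v ! i\<bar> \<le> e)"
proof (cases "length u = length v")
  case True
  have "Max (insert 0 {\<bar>u ! i - v ! i\<bar> | i. i < length u}) \<le> e \<longleftrightarrow>
      (\<forall>i<length u. \<bar>u ! i - v ! i\<bar> \<le> e)"
    using assms by (subst Max_le_iff) auto
  then show ?thesis using True by (simp add: Delta_p_def)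
qed (simp add: Delta_p_def)

theorem theorem1:
  fixes M :: "'a measure" and Phi0 Phix :: "'a \<Rightarrow> complex set"
    and lam dv eps :: real and x :: complex
  assumes "prob_space M" and "lam > 0" and "dv > 0" and "eps \<ge> 0"
    and "poisson_pp M Phi0 lam" and "poisson_pp M Phix lam"
    and "indep_pp M Phi0 Phix"
  shows "measure M {\<omega> \<in> space M.
            Delta_p (range_vec dv 0 (Phi0 \<omega>)) (range_vec dv x (Phix \<omega>)) > ereal eps}
         = (let m = lam * pi * dv ^ 2 in
            if eps < dv
            then 1 - exp (- 2 * m) * bessel_I0 (2 * m *
                   sqrt ((8 * dv ^ 3 * eps - 6 * dv ^ 2 * eps ^ 2 + eps ^ 4) / (3 * dv ^ 4)))
            else 1 - exp (- 2 * m) * bessel_I0 (2 * m))"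
proof -
  interpret prob_space M by fact
  note pp = assms(5) and pp' = assms(6) and d = assms(3)
  define m where "m = lam * pi * dv\<^sup>2"
  define q where "q = close_prob dv eps"
  \<comment> \<open>The complementary event is split by the common length \<open>k\<close> of the
    two vectors.\<close>
  define Z where "Z k = {\<omega> \<in> space M. length (range_vec dv 0 (Phi0 \<omega>)) = k \<and>
    length (range_vec dv x (Phix \<omega>)) = k \<and>
    (\<forall>i<k. \<bar>nth_range dv 0 i (Phi0 \<omega>) - nth_range dv x i (Phix \<omega>)\<bar> \<le> eps)}" for k
  note [measurable] = measurable_length_range_vec[OF pp d, of 0] measurable_length_range_vec[OF pp' d, of x]
    measurable_nth_range[OF pp d, of 0] measurable_nth_range[OF pp' d, of x]
  have Z: "Z k \<in> events" for k unfolding Z_def by measurable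
  have q0: "q \<ge> 0" by (simp add: q_def close_prob_def)
  have "prob (Z k) = exp (- 2 * m) * ((2 * m * sqrt q / 2) ^ k / fact k)\<^sup>2" for k
  proof -
    have "prob (Z k) = (exp (- m) * m ^ k / fact k)\<^sup>2 * q ^ k"
      unfolding Z_def m_def q_def using assms by (intro prob_ranges_close)
    also have "(exp (- m))\<^sup>2 = exp (- 2 * m)"
      by (simp add: power2_eq_square exp_add[symmetric])
    then have "(exp (- m) * m ^ k / fact k)\<^sup>2 * q ^ k = exp (- 2 * m) * ((m ^ k)\<^sup>2 * q ^ k / (fact k)\<^sup>2)"
      by (simp add: power_mult_distrib power_divide)
    \<comment> \<open>The square root brings \<open>q ^ k\<close> inside the square, matching the
      terms of \<open>bessel_I0\<close> at the argument \<open>2 * m * sqrt q\<close>.\<close>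
    also have "(m ^ k)\<^sup>2 * q ^ k = ((m * sqrt q) ^ k)\<^sup>2"
    proof -
      have "q ^ k = ((sqrt q) ^ k)\<^sup>2"
        using q0 by (simp add: power2_eq_square flip: power_mult_distrib)
      then show ?thesis by (simp add: power_mult_distrib)
    qed
    finally show ?thesis by (simp add: power_divide)
  qed
  moreover have "(\<lambda>k. prob (Z k)) sums prob (\<Union>k. Z k)"
    by (rule finite_measure_UNION) (use Z in \<open>auto simp: disjoint_family_on_def Z_def\<close>)
  ultimately have "(\<lambda>k. exp (- 2 * m) * ((2 * m * sqrt q / 2) ^ k / fact k)\<^sup>2) sums prob (\<Union>k. Z k)"
    by simp
  \<comment> \<open>Cancelling the exponential isolates the Bessel series, whose convergence is
    inherited from countable additivity.\<close>
  then have "(\<lambda>k. exp (2 * m) * (exp (- 2 * m) * ((2 * m * sqrt q / 2) ^ k / fact k)\<^sup>2))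
      sums (exp (2 * m) * prob (\<Union>k. Z k))"
    by (rule sums_mult)
  then have "(\<lambda>k. ((2 * m * sqrt q / 2) ^ k / fact k)\<^sup>2) sums (exp (2 * m) * prob (\<Union>k. Z k))"
    by (simp add: mult.assoc[symmetric] exp_add[symmetric])
  then have "bessel_I0 (2 * m * sqrt q) = exp (2 * m) * prob (\<Union>k. Z k)"
    unfolding bessel_I0_def by (rule sums_unique[symmetric])
  then have PZ: "prob (\<Union>k. Z k) = exp (- 2 * m) * bessel_I0 (2 * m * sqrt q)"
    by (simp add: mult.assoc[symmetric] exp_add[symmetric])
  have "{\<omega> \<in> space M. Delta_p (range_vec dv 0 (Phi0 \<omega>)) (range_vec dv x (Phix \<omega>)) > ereal eps}
      = space M - (\<Union>k. Z k)"
    unfolding not_le[symmetric] Delta_p_le_iff[OF assms(4)]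
    by (auto simp: Z_def nth_range_def) (metis not_le)
  then have "prob {\<omega> \<in> space M. Delta_p (range_vec dv 0 (Phi0 \<omega>)) (range_vec dv x (Phix \<omega>)) > ereal eps}
      = 1 - exp (- 2 * m) * bessel_I0 (2 * m * sqrt q)"
    using prob_compl[of "\<Union>k. Z k"] Z PZ by auto
  \<comment> \<open>For \<open>eps\<close> at least \<open>dv\<close> the value \<open>q = 1\<close>
    turns the general formula into the second branch.\<close>
  moreover have "q = (if eps < dv
      then (8 * dv ^ 3 * eps - 6 * dv ^ 2 * eps ^ 2 + eps ^ 4) / (3 * dv ^ 4) else 1)"
    unfolding q_def by (rule close_prob_eq[OF assms(3,4)])
  ultimately show ?thesis
    by (simp add: Let_def m_def)
qed

end
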